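(* Let $q$ be an odd prime power and let $m \ge 2$ be an integer with $\gcd(q-1, m(m-1)) = 2$. Then: (i) every $d \in \mathbb{F}_q$ is the discriminant of the same number of monic polynomials of degree $m$ in $\mathbb{F}_q[x]$ (namely $q^{m-1}$ of them); (ii) the discriminants of monic irreducible polynomials of degree $m$ in $\mathbb{F}_q[x]$ are equally distributed among half the elements of $\mathbb{F}_q^\times$: there is a subset $A \subseteq \mathbb{F}_q^\times$ with $|A| = (q-1)/2$ such that every monic irreducible polynomial of degree $m$ has discriminant in $A$, and every element of $A$ is the discriminant of the same (positive) number of monic irreducible polynomials of degree $m$ in $\mathbb{F}_q[x]$.
   Context: For a nonconstant polynomial $f$ of degree $m \ge 2$ over a field $K$ with leading coefficient $a_m$, factored as $f = a_m\prod_{i=1}^m (x-\alpha_i)$ in a splitting field, $\operatorname{disc}(f) = a_m^{2m-2}\prod_{i<j}(\alpha_i-\alpha_j)^2$; for linear $f$, $\operatorname{disc}(f) = 1$. $\mathbb{F}_q$ denotes the finite field with $q$ elements. *)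

theory Defs
  imports "HOL-Algebra.Algebraic_Closure_Type"
begin

text \<open>Discriminant of a polynomial over a field, computed from its roots in the
algebraic closure (which contains a splitting field):
disc f = a_m^(2m-2) * prod_{i<j} (alpha_i - alpha_j)^2 for degree m >= 2,
and disc f = 1 for degree <= 1 (the paper's convention for linear f).\<close>

definition poly_roots_list :: "'a :: field poly \<Rightarrow> 'a alg_closure list" where
  "poly_roots_list f = (SOME xs. mset xs = proots (map_poly to_ac f))"

definition disc :: "'a :: field poly \<Rightarrow> 'a" where
  "disc f =
     (if degree f \<le> 1 then 1
      else (let m = degree f; xs = poly_roots_list f in
            of_ac (to_ac (lead_coeff f) ^ (2 * m - 2) *
                   (\<Prod>i<m. \<Prod>j\<in>{i<..<m}. (xs ! i - xs ! j) ^ 2))))"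

end

theory Submission
  imports Defs
begin

text \<open>
  The roots of an irreducible polynomial over \<open>F\<^sub>q\<close> form one cycle of the Frobenius map,
  so its discriminant is a square iff its degree is odd. Since the discriminant of a product is
  the product of the discriminants times the square of the resultant,
  \<open>\<mu>(f) = (-1)^(deg f) \<chi>(disc f)\<close>, with \<open>\<chi>\<close> the quadratic character, behaves like
  the Moebius function. Summing \<open>\<mu>(d)\<close> over all \<open>d\<close> dividing some monic \<open>f\<close> of
  degree \<open>n\<close> gives \<open>\<Sum>\<chi>(disc f) = 0\<close> over the monic \<open>f\<close> of degree \<open>n \<ge> 2\<close>;
  summing over all \<open>d\<close> with \<open>d\<^sup>2\<close> dividing \<open>f\<close> gives \<open>q^(n-1)\<close> polynomials of
  discriminant zero. Multiplying all roots by \<open>c\<close> multiplies the discriminant by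
  \<open>c^(m(m-1))\<close>, which by the gcd condition is an arbitrary nonzero square; it preserves
  irreducibility. Hence the number of (irreducible) polynomials with discriminant \<open>d\<close>
  depends only on \<open>\<chi>(d)\<close>.
\<close>

section \<open>The Frobenius map on the algebraic closure\<close>

definition frob :: "'a :: {finite, field} alg_closure \<Rightarrow> 'a alg_closure" where
  "frob x = x ^ card (UNIV :: 'a set)"

lemma card_UNIV_field_gt_1: "card (UNIV :: 'a :: {finite, field} set) > 1"
proof -
  have "card {0, 1 :: 'a} \<le> card (UNIV :: 'a set)" by (intro card_mono) auto
  thus ?thesis by simp
qed

text \<open>Multiplication by a nonzero \<open>x\<close> permutes the nonzero elements; comparing
  their products gives \<open>x ^ (q - 1) = 1\<close>.\<close>

lemma power_card_UNIV_eq_same: "x ^ card (UNIV :: 'a set) = (x :: 'a :: {finite, field})"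
proof (cases "x = 0")
  case False
  let ?q = "card (UNIV :: 'a set)"
  have "(\<Prod>y\<in>UNIV-{0}. x * y) = (\<Prod>y\<in>UNIV-{0}. y)"
    by (rule prod.reindex_bij_witness[of _ "\<lambda>y. y / x" "\<lambda>y. x * y"]) (use False in auto)
  moreover have "(\<Prod>y\<in>UNIV-{0}. x * y) = x ^ (?q - 1) * \<Prod>(UNIV-{0})"
    by (simp add: prod.distrib)
  ultimately have "x ^ (?q - 1) = 1"
    by simp
  moreover have "x ^ ?q = x * x ^ (?q - 1)"
    using card_UNIV_field_gt_1[where ?'a='a] by (simp flip: power_Suc)
  ultimately show ?thesis by simp
qed (use card_UNIV_field_gt_1[where ?'a='a] in auto)

text \<open>The polynomial \<open>(X + 1) ^ q - X ^ q - 1\<close> has degree less than \<open>q\<close> but \<open>q\<close> roots.\<close>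
lemma of_nat_card_UNIV_choose:
  assumes "0 < k" "k < card (UNIV :: 'a set)"
  shows   "of_nat (card (UNIV :: 'a set) choose k) = (0 :: 'a :: {finite, field})"
proof -
  define q where "q = card (UNIV :: 'a set)"
  define p :: "'a poly" where "p = (\<Sum>k\<in>{1..<q}. monom (of_nat (q choose k)) k)"
  have q: "q > 1" using card_UNIV_field_gt_1 by (simp add: q_def)
  have root: "poly p x = 0" for x
  proof -
    have "x + 1 = (x + 1) ^ q"
      by (simp add: q_def power_card_UNIV_eq_same)
    also have "\<dots> = (\<Sum>k\<le>q. of_nat (q choose k) * x ^ k)"
      by (simp add: binomial_ring)
    also have "{..q} = insert 0 (insert q {1..<q})"
      using q by auto
    also have "(\<Sum>k\<in>\<dots>. of_nat (q choose k) * x ^ k) = 1 + x ^ q + poly p x"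
      using q by (subst sum.insert; simp add: p_def poly_sum poly_monom)
    also have "x ^ q = x"
      by (simp add: q_def power_card_UNIV_eq_same)
    finally show ?thesis by (simp add: algebra_simps)
  qed
  have "degree p < q"
    unfolding p_def using q
    by (intro degree_sum_less) (auto intro: le_less_trans[OF degree_monom_le])
  have "p = 0"
  proof (rule ccontr)
    assume "p \<noteq> 0"
    hence "card {x. poly p x = 0} \<le> degree p" by (rule card_poly_roots_bound)
    thus False using root \<open>degree p < q\<close> by (simp add: q_def)
  qed
  hence "coeff p k = 0" by simp
  thus ?thesis using assms
    by (simp add: p_def coeff_sum coeff_monom q_def)
qed

lemma of_nat_card_UNIV_choose_ac:
  assumes "0 < k" "k < card (UNIV :: 'a set)"
  shows   "of_nat (card (UNIV :: 'a set) choose k) = (0 :: 'a :: {finite, field} alg_closure)"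
  using of_nat_card_UNIV_choose[OF assms] by (metis to_ac_0 to_ac_of_nat)

lemma of_nat_card_UNIV_ac:
  "of_nat (card (UNIV :: 'a set)) = (0 :: 'a :: {finite, field} alg_closure)"
  using of_nat_card_UNIV_choose_ac[of 1, where ?'a='a] card_UNIV_field_gt_1[where ?'a='a] by simp

lemma frob_add: "frob (x + y) = frob x + frob y"
proof -
  define q where "q = card (UNIV :: 'a set)"
  have q: "q > 1" using card_UNIV_field_gt_1 by (simp add: q_def)
  have "(x + y) ^ q = (\<Sum>k\<le>q. of_nat (q choose k) * x ^ k * y ^ (q - k))"
    by (rule binomial_ring)
  also have "\<dots> = (\<Sum>k\<in>{0, q}. of_nat (q choose k) * x ^ k * y ^ (q - k))"
    by (rule sum.mono_neutral_right) (auto simp: q_def of_nat_card_UNIV_choose_ac)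
  also have "\<dots> = x ^ q + y ^ q" using q by simp
  finally show ?thesis by (simp add: frob_def q_def)
qed

lemma frob_0 [simp]: "frob 0 = 0" and frob_1 [simp]: "frob 1 = 1"
  by (simp_all add: frob_def finite_UNIV_card_ge_0)

lemma frob_mult: "frob (x * y) = frob x * frob y"
  by (simp add: frob_def power_mult_distrib)

lemma frob_power: "frob (x ^ n) = frob x ^ n"
  by (simp add: frob_def power_commutes flip: power_mult) (simp add: mult.commute)

lemma frob_minus: "frob (-x) = -frob x"
  using frob_add[of x "-x"] by (simp add: add_eq_0_iff)

lemma frob_diff: "frob (x - y) = frob x - frob y"
  using frob_add[of x "-y"] by (simp add: frob_minus)

lemma frob_sum: "frob (sum f A) = (\<Sum>x\<in>A. frob (f x))"
  by (induction A rule: infinite_finite_induct) (simp_all add: frob_add)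

lemma frob_prod_list: "frob (prod_list xs) = prod_list (map frob xs)"
  by (induction xs) (simp_all add: frob_mult)

lemma frob_eq_0_iff [simp]: "frob (x :: 'a :: {finite, field} alg_closure) = 0 \<longleftrightarrow> x = 0"
  using card_UNIV_field_gt_1[where ?'a='a] by (auto simp: frob_def)

lemma inj_frob: "inj frob"
proof (rule injI)
  fix x y :: "'a alg_closure" assume "frob x = frob y"
  hence "frob (x - y) = 0" by (simp add: frob_diff)
  thus "x = y" by simp
qed

lemma frob_to_ac [simp]: "frob (to_ac x) = to_ac x"
  by (simp add: frob_def power_card_UNIV_eq_same flip: to_ac_power)

text \<open>The equation \<open>y ^ q = y\<close> has at most \<open>q\<close> solutions in the
  closure, and the \<open>q\<close> embedded elements of the base field are already solutions. This
  is the test for descending from the closure.\<close>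

lemma frob_fixed_iff: "frob x = x \<longleftrightarrow> x \<in> range (to_ac :: 'a :: {finite, field} \<Rightarrow> _)"
proof
  assume x: "frob x = x"
  define q where "q = card (UNIV :: 'a set)"
  have q: "q > 1" using card_UNIV_field_gt_1 by (simp add: q_def)
  define p :: "'a alg_closure poly" where "p = monom 1 q - monom 1 1"
  have "degree p = q"
    using q degree_add_eq_left[of "- monom 1 1" "monom (1 :: 'a alg_closure) q"]
    by (simp add: p_def degree_monom_eq)
  hence "p \<noteq> 0" using q by auto
  have p: "poly p y = 0 \<longleftrightarrow> frob y = y" for y
    by (simp add: p_def poly_monom frob_def q_def)
  have "finite {y. poly p y = 0}" using \<open>p \<noteq> 0\<close> by (rule poly_roots_finite)
  moreover have "range to_ac \<subseteq> {y. poly p y = 0}" by (auto simp: p)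
  moreover have "card {y. poly p y = 0} \<le> card (range (to_ac :: 'a \<Rightarrow> _))"
    using card_poly_roots_bound[OF \<open>p \<noteq> 0\<close>] \<open>degree p = q\<close>
    by (simp add: card_image inj_to_ac q_def)
  ultimately have "range to_ac = {y. poly p y = 0}"
    by (intro card_seteq)
  thus "x \<in> range to_ac" using x p by auto
qed auto

lemma frob_funpow: "(frob ^^ n) x = x ^ (card (UNIV :: 'a set) ^ n)"
  for x :: "'a :: {finite, field} alg_closure"
  by (induction n) (simp_all add: frob_def power_mult mult.commute[of _ "_ ^ _"])

section \<open>Roots and Frobenius orbits\<close>

abbreviation ac_poly :: "'a :: field poly \<Rightarrow> 'a alg_closure poly" where
  "ac_poly \<equiv> map_poly to_ac"

lemma coeff_ac_poly [simp]: "coeff (ac_poly f) i = to_ac (coeff f i)"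
  by (simp add: coeff_map_poly)

lemma degree_ac_poly [simp]: "degree (ac_poly f) = degree f"
  by (simp add: degree_map_poly)

lemma ac_poly_mult: "ac_poly (f * g) = ac_poly f * ac_poly g"
  by (intro poly_eqI) (simp add: coeff_mult to_ac_sum)

lemma ac_poly_add: "ac_poly (f + g) = ac_poly f + ac_poly g"
  by (intro poly_eqI) simp

lemma ac_poly_eq_iff [simp]: "ac_poly f = ac_poly g \<longleftrightarrow> f = g"
  by (auto simp: poly_eq_iff)

lemma ac_poly_eq_0_iff [simp]: "ac_poly f = 0 \<longleftrightarrow> f = 0"
  by (auto simp: poly_eq_iff)

text \<open>Division with remainder survives base change: \<open>ac_poly g\<close> divides
  \<open>ac_poly (f mod g)\<close>, whose degree is too small unless it is zero.\<close>

lemma ac_poly_dvd_iff: "ac_poly g dvd ac_poly f \<longleftrightarrow> g dvd f"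
proof
  assume dvd: "ac_poly g dvd ac_poly f"
  show "g dvd f"
  proof (cases "g = 0")
    case False
    have "ac_poly f = ac_poly g * ac_poly (f div g) + ac_poly (f mod g)"
      by (simp flip: ac_poly_mult ac_poly_add)
    hence "ac_poly g dvd ac_poly (f mod g)"
      using dvd by (simp add: dvd_add_right_iff)
    hence "ac_poly (f mod g) = 0"
      using degree_mod_less'[of g f] False dvd_imp_degree_le[of "ac_poly g" "ac_poly (f mod g)"]
      by fastforce
    thus ?thesis by (simp add: mod_eq_0_iff_dvd)
  qed (use dvd in auto)
qed (auto simp: ac_poly_mult elim!: dvdE)

lemma poly_ac_poly_frob: "poly (ac_poly f) (frob x) = frob (poly (ac_poly f) x)"
  by (simp add: poly_altdef frob_sum frob_mult frob_power)

text \<open>Roots are kept in a list because the product of their differences depends on their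
  order.\<close>

definition poly_of_roots :: "'a :: idom list \<Rightarrow> 'a poly" where
  "poly_of_roots xs = (\<Prod>x\<leftarrow>xs. [:-x, 1:])"

lemma poly_of_roots_simps [simp]:
  "poly_of_roots [] = 1"
  "poly_of_roots (x # xs) = [:-x, 1:] * poly_of_roots xs"
  "poly_of_roots (xs @ ys) = poly_of_roots xs * poly_of_roots ys"
  by (simp_all add: poly_of_roots_def)

lemma poly_of_roots_nonzero [simp]: "poly_of_roots xs \<noteq> 0"
  by (induction xs) (simp_all del: mult_pCons_left)

lemma degree_poly_of_roots [simp]: "degree (poly_of_roots xs) = length xs"
  by (induction xs) (simp_all add: degree_mult_eq del: mult_pCons_left)

lemma lead_coeff_poly_of_roots [simp]: "coeff (poly_of_roots xs) (length xs) = 1"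
proof -
  have "lead_coeff (poly_of_roots xs) = 1"
    by (induction xs) (simp_all add: lead_coeff_mult del: mult_pCons_left)
  thus ?thesis by simp
qed

lemma poly_poly_of_roots_eq_0_iff: "poly (poly_of_roots xs) x = 0 \<longleftrightarrow> x \<in> set xs"
  by (induction xs) auto

lemma proots_poly_of_roots [simp]: "proots (poly_of_roots xs) = mset xs"
  by (induction xs) (simp_all add: proots_mult del: mult_pCons_left)

lemma poly_of_roots_cong: "mset xs = mset ys \<Longrightarrow> poly_of_roots xs = poly_of_roots ys"
  unfolding poly_of_roots_def by (metis mset_map prod_mset_prod_list)

lemma poly_of_roots_dvd:
  assumes "distinct xs" "\<And>x. x \<in> set xs \<Longrightarrow> poly f x = 0"
  shows   "poly_of_roots xs dvd f"
  using assms
proof (induction xs arbitrary: f)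
  case (Cons x xs)
  then obtain g where g: "f = [:-x, 1:] * g"
    by (metis dvdE list.set_intros(1) poly_eq_0_iff_dvd)
  have "poly g y = 0" if "y \<in> set xs" for y
    using Cons.prems(1) Cons.prems(2)[of y] that by (auto simp: g)
  hence "poly_of_roots xs dvd g"
    using Cons by auto
  thus ?case by (simp add: g mult_dvd_mono del: mult_pCons_left)
qed auto

lemma splits_alg_closed:
  fixes f :: "'a :: alg_closed_field poly"
  assumes "lead_coeff f = 1"
  obtains xs where "f = poly_of_roots xs"
proof -
  obtain A where A: "f = smult (lead_coeff f) (\<Prod>x\<in>#A. [:-x, 1:])"
    using alg_closed_imp_factorization[of f] assms by force
  obtain xs where "A = mset xs" by (metis ex_mset)
  thus ?thesis using that[of xs] A assms
    by (simp add: poly_of_roots_def flip: mset_map prod_mset_prod_list)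
qed

lemma ac_poly_splits:
  assumes "lead_coeff f = 1"
  obtains xs where "ac_poly f = poly_of_roots xs"
  using splits_alg_closed[of "ac_poly f"] assms by auto

lemma map_poly_frob_poly_of_roots:
  "map_poly frob (poly_of_roots xs) = poly_of_roots (map frob xs)"
proof (induction xs)
  case (Cons x xs)
  have "map_poly frob ([:-x, 1:] * p) = [:-frob x, 1:] * map_poly frob p" for p
    by (intro poly_eqI)
       (simp add: coeff_map_poly coeff_pCons frob_minus frob_add frob_mult frob_diff split: nat.splits)
  thus ?case using Cons by (simp del: mult_pCons_left)
qed auto

text \<open>The coefficients come from the base field and are fixed by \<open>frob\<close>, so
  applying \<open>frob\<close> to all roots gives the same polynomial.\<close>

lemma mset_map_frob_roots:
  assumes "ac_poly f = poly_of_roots xs"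
  shows   "mset (map frob xs) = mset xs"
proof -
  have "poly_of_roots (map frob xs) = map_poly frob (ac_poly f)"
    by (simp add: assms map_poly_frob_poly_of_roots)
  also have "\<dots> = poly_of_roots xs"
    by (intro poly_eqI) (simp add: coeff_map_poly flip: assms)
  finally show ?thesis by (metis proots_poly_of_roots)
qed

text \<open>Converse of \<open>mset_map_frob_roots\<close>: a root multiset stable under
  \<open>frob\<close> gives coefficients fixed by \<open>frob\<close>, which lie in the base field
  by \<open>frob_fixed_iff\<close>.\<close>

lemma poly_of_roots_descends:
  assumes "mset (map frob xs) = mset xs"
  obtains f where "ac_poly f = poly_of_roots xs"
proof -
  have "map_poly frob (poly_of_roots xs) = poly_of_roots xs"
    unfolding map_poly_frob_poly_of_roots using assms by (rule poly_of_roots_cong)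
  hence "frob (coeff (poly_of_roots xs) i) = coeff (poly_of_roots xs) i" for i
    by (metis coeff_map_poly frob_0)
  hence "coeff (poly_of_roots xs) i \<in> range to_ac" for i
    by (simp add: frob_fixed_iff)
  hence "ac_poly (map_poly of_ac (poly_of_roots xs)) = poly_of_roots xs"
    by (intro poly_eqI) (simp add: coeff_map_poly to_ac_of_ac)
  thus ?thesis by (rule that)
qed

lemma monic_of_ac_poly:
  assumes "ac_poly f = poly_of_roots xs"
  shows   "lead_coeff f = 1" "degree f = length xs"
proof -
  show deg: "degree f = length xs"
    using arg_cong[OF assms, of degree] by simp
  have "to_ac (lead_coeff f) = coeff (ac_poly f) (length xs)"
    by (simp add: deg)
  thus "lead_coeff f = 1" by (simp add: assms)
qed

section \<open>Frobenius orbits and minimal polynomials\<close>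

definition frob_orbit :: "nat \<Rightarrow> 'a :: {finite, field} alg_closure \<Rightarrow> 'a alg_closure list" where
  "frob_orbit n x = map (\<lambda>i. (frob ^^ i) x) [0..<n]"

lemma length_frob_orbit [simp]: "length (frob_orbit n x) = n"
  by (simp add: frob_orbit_def)

text \<open>Since \<open>(frob ^^ n) x = x\<close>, the last entry is sent back to the first;
  \<open>n\<close> may be any positive period, not only the least.\<close>

lemma map_frob_orbit:
  assumes "n > 0" "(frob ^^ n) x = x"
  shows   "map frob (frob_orbit n x) = tl (frob_orbit n x) @ [hd (frob_orbit n x)]"
proof -
  have "map frob (frob_orbit n x) = map (\<lambda>i. (frob ^^ i) x) (map Suc [0..<n])"
    by (simp add: frob_orbit_def)
  also have "map Suc [0..<n] = [1..<n] @ [n]"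
    using assms(1) by (simp add: map_Suc_upt)
  also have "map (\<lambda>i. (frob ^^ i) x) ([1..<n] @ [n]) = tl (frob_orbit n x) @ [hd (frob_orbit n x)]"
    using assms by (simp add: frob_orbit_def hd_map map_tl[symmetric] upt_rec[of 0 n])
  finally show ?thesis .
qed

lemma mset_map_frob_orbit:
  assumes "n > 0" "(frob ^^ n) x = x"
  shows   "mset (map frob (frob_orbit n x)) = mset (frob_orbit n x)"
proof -
  have "frob_orbit n x \<noteq> []" using assms by (simp add: frob_orbit_def)
  thus ?thesis unfolding map_frob_orbit[OF assms]
    by (cases "frob_orbit n x") auto
qed

lemma frob_funpow_root:
  "poly (ac_poly f) x = 0 \<Longrightarrow> poly (ac_poly f) ((frob ^^ i) x) = 0"
  by (induction i) (simp_all add: poly_ac_poly_frob)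

lemma inj_frob_funpow: "inj (frob ^^ i)"
  by (rule inj_fn[OF inj_frob])

lemma frob_funpow_eqD:
  assumes "(frob ^^ i) x = (frob ^^ j) x" "i \<le> j"
  shows   "(frob ^^ (j - i)) x = x"
proof -
  have "(frob ^^ i) ((frob ^^ (j - i)) x) = (frob ^^ i) x"
    using assms by (simp flip: funpow_add comp_apply[of "frob ^^ i"])
  thus ?thesis using inj_frob_funpow by (auto dest: injD)
qed

lemma distinct_frob_orbit:
  assumes "\<And>d. 0 < d \<Longrightarrow> d < n \<Longrightarrow> (frob ^^ d) x \<noteq> x"
  shows   "distinct (frob_orbit n x)"
proof -
  have "i = j" if "i \<le> j" "j < n" "(frob ^^ i) x = (frob ^^ j) x" for i j
    using assms[of "j - i"] frob_funpow_eqD[OF that(3,1)] that by fastforce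
  hence "inj_on (\<lambda>i. (frob ^^ i) x) {..<n}"
    by (intro inj_onI) (metis lessThan_iff nle_le)
  thus ?thesis
    by (simp add: frob_orbit_def distinct_map atLeast0LessThan)
qed

text \<open>A factor vanishing at \<open>x\<close> vanishes on the whole orbit, so it has degree at
  least \<open>n\<close> and the other factor is constant.\<close>

lemma frob_orbit_irreducible:
  assumes "n > 0" "distinct (frob_orbit n x)" "ac_poly f = poly_of_roots (frob_orbit n x)"
  shows   "irreducible f"
proof (rule irreducibleI)
  note f = monic_of_ac_poly[OF assms(3), simplified]
  show "f \<noteq> 0" using f assms by auto
  show "\<not>is_unit f" using f assms \<open>f \<noteq> 0\<close> by (simp add: is_unit_iff_degree)
  fix a b assume ab: "f = a * b"
  hence nz: "a \<noteq> 0" "b \<noteq> 0" using \<open>f \<noteq> 0\<close> by auto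
  have *: "n \<le> degree g" if "g \<noteq> 0" "poly (ac_poly g) x = 0" for g
  proof -
    have "poly_of_roots (frob_orbit n x) dvd ac_poly g"
      using assms(2) frob_funpow_root[OF that(2)]
      by (intro poly_of_roots_dvd) (auto simp: frob_orbit_def)
    thus ?thesis using that(1) by (auto dest: dvd_imp_degree_le)
  qed
  have deg: "n = degree a + degree b"
    using f ab nz by (simp add: degree_mult_eq)
  have "poly (ac_poly f) x = 0"
    using \<open>n > 0\<close> unfolding assms(3) poly_poly_of_roots_eq_0_iff
    by (force simp: frob_orbit_def)
  hence "poly (ac_poly a) x = 0 \<or> poly (ac_poly b) x = 0"
    by (simp add: ab ac_poly_mult)
  thus "is_unit a \<or> is_unit b"
    using *[of a] *[of b] nz deg by (auto simp: is_unit_iff_degree)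
qed

text \<open>The orbit lies in the finite root set of a polynomial over the base field, so it
  repeats; injectivity of \<open>frob\<close> moves the repetition back to \<open>x\<close>.\<close>

lemma ex_frob_period:
  fixes x :: "'a :: {finite, field} alg_closure"
  shows "\<exists>n>0. (frob ^^ n) x = x"
proof -
  obtain p :: "'a poly" where p: "p \<noteq> 0" "poly (ac_poly p) x = 0"
    by (rule alg_closure_algebraic)
  have "range (\<lambda>i. (frob ^^ i) x) \<subseteq> {y. poly (ac_poly p) y = 0}"
    using frob_funpow_root[OF p(2)] by auto
  hence "finite (range (\<lambda>i. (frob ^^ i) x))"
    by (rule finite_subset) (use p(1) in \<open>auto intro: poly_roots_finite\<close>)
  hence "\<not>inj (\<lambda>i. (frob ^^ i) x)"
    using finite_imageD by blast
  then obtain i j where "i \<noteq> j" "(frob ^^ i) x = (frob ^^ j) x"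
    unfolding inj_def by blast
  then obtain i j where "i < j" "(frob ^^ i) x = (frob ^^ j) x"
    by (metis linorder_neqE_nat)
  thus ?thesis using frob_funpow_eqD[of i x j] by (intro exI[of _ "j - i"]) auto
qed

text \<open>Here \<open>n\<close> is the least period and \<open>p\<close> the minimal polynomial of
  \<open>x\<close> over the base field.\<close>

lemma frob_orbit_poly:
  fixes x :: "'a :: {finite, field} alg_closure"
  obtains n p where "n > 0" "(frob ^^ n) x = x" "distinct (frob_orbit n x)"
    "ac_poly p = poly_of_roots (frob_orbit n x)" "irreducible p"
    "\<And>f. poly (ac_poly f) x = 0 \<Longrightarrow> p dvd f"
proof -
  define n where "n = (LEAST n. n > 0 \<and> (frob ^^ n) x = x)"
  have n: "n > 0" "(frob ^^ n) x = x"
    using LeastI_ex[OF ex_frob_period[of x, unfolded Bex_def]] by (auto simp: n_def)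
  have dist: "distinct (frob_orbit n x)"
    by (rule distinct_frob_orbit) (auto simp: n_def dest: not_less_Least)
  obtain p where p: "ac_poly p = poly_of_roots (frob_orbit n x)"
    using poly_of_roots_descends mset_map_frob_orbit[OF n] by blast
  have "p dvd f" if "poly (ac_poly f) x = 0" for f
  proof -
    have "poly_of_roots (frob_orbit n x) dvd ac_poly f"
      using dist frob_funpow_root[OF that]
      by (intro poly_of_roots_dvd) (auto simp: frob_orbit_def)
    thus ?thesis by (simp add: ac_poly_dvd_iff flip: p)
  qed
  thus ?thesis
    using that[OF n dist p frob_orbit_irreducible[OF n(1) dist p]] by blast
qed

lemma monic_dvd_irreducible_eq:
  fixes p f :: "'a :: field poly"
  assumes "lead_coeff p = 1" "lead_coeff f = 1" "irreducible f" "p dvd f" "\<not>is_unit p"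
  shows   "p = f"
proof -
  obtain g where g: "f = p * g" using assms by (auto elim: dvdE)
  with assms have "is_unit g" by (auto dest: irreducibleD)
  then obtain c where "g = [:c:]" by (auto simp: is_unit_poly_iff)
  with g have "f = smult c p" by simp
  with assms show ?thesis by (cases "c = 0") auto
qed

text \<open>A monic irreducible \<open>f\<close> equals the minimal polynomial of any of its roots,
  so a single orbit without repetitions exhausts its roots.\<close>

lemma irreducible_roots:
  fixes f :: "'a :: {finite, field} poly"
  assumes "irreducible f" "lead_coeff f = 1"
  obtains x where "degree f > 0" "(frob ^^ degree f) x = x" "distinct (frob_orbit (degree f) x)"
    "ac_poly f = poly_of_roots (frob_orbit (degree f) x)"
proof -
  have "degree f > 0"
    using assms by (auto simp: irreducible_def is_unit_iff_degree)
  then obtain x where x: "poly (ac_poly f) x = 0"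
    using alg_closed_imp_poly_has_root[of "ac_poly f"] by auto
  obtain n p where p: "n > 0" "(frob ^^ n) x = x" "distinct (frob_orbit n x)"
      "ac_poly p = poly_of_roots (frob_orbit n x)" "irreducible p"
      "\<And>f. poly (ac_poly f) x = 0 \<Longrightarrow> p dvd f"
    using frob_orbit_poly[of x] by blast
  have "p = f"
    using assms p(5,6) x monic_of_ac_poly[OF p(4)]
    by (intro monic_dvd_irreducible_eq) (auto simp: irreducible_def)
  moreover from this have "n = degree f"
    using monic_of_ac_poly[OF p(4)] by simp
  ultimately show ?thesis using that p \<open>degree f > 0\<close> by blast
qed

lemma ex_irreducible_dvd:
  fixes f :: "'a :: {finite, field} poly"
  assumes "degree f > 0"
  obtains p where "irreducible p" "lead_coeff p = 1" "p dvd f"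
proof -
  obtain x where "poly (ac_poly f) x = 0"
    using alg_closed_imp_poly_has_root[of "ac_poly f"] assms by auto
  thus ?thesis using frob_orbit_poly[of x] monic_of_ac_poly that by metis
qed

section \<open>Existence of irreducible polynomials of every positive degree\<close>

lemma card_frob_funpow_fixed:
  assumes "n > 0"
  shows "card {x :: 'a :: {finite, field} alg_closure. (frob ^^ n) x = x} = card (UNIV :: 'a set) ^ n"
proof -
  define N where "N = card (UNIV :: 'a set) ^ n"
  have N: "N > 1"
    unfolding N_def by (rule one_less_power[OF card_UNIV_field_gt_1 assms])
  define p :: "'a alg_closure poly" where "p = monom 1 N - monom 1 1"
  have deg: "degree p = N"
    using N degree_add_eq_left[of "- monom 1 1" "monom (1 :: 'a alg_closure) N"]
    by (simp add: p_def degree_monom_eq)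
  have "lead_coeff p = 1"
    unfolding deg using N by (simp add: p_def)
  then obtain xs where xs: "p = poly_of_roots xs"
    by (rule splits_alg_closed)
  have "of_nat N = (0 :: 'a alg_closure)"
    using assms by (simp add: N_def of_nat_card_UNIV_ac)
  \<comment> \<open>As \<open>q ^ n\<close> vanishes in the closure, the derivative is a nonzero
    constant, which rules out double roots.\<close>
  hence "pderiv p = -1"
    by (simp add: p_def pderiv_diff pderiv_monom monom_eq_1)
  have "distinct xs"
  proof (rule ccontr)
    assume "\<not>distinct xs"
    then obtain x us vs ws where "xs = us @ [x] @ vs @ [x] @ ws"
      using not_distinct_decomp by blast
    hence "poly_of_roots xs = poly_of_roots (x # x # us @ vs @ ws)"
      by (intro poly_of_roots_cong) simp
    hence "p = [:-x, 1:] * ([:-x, 1:] * poly_of_roots (us @ vs @ ws))"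
      by (simp only: xs poly_of_roots_simps)
    hence "poly (pderiv p) x = 0"
      by (simp add: pderiv_mult del: mult_pCons_left)
    thus False using \<open>pderiv p = -1\<close> by simp
  qed
  have "{x :: 'a alg_closure. (frob ^^ n) x = x} = {x. poly p x = 0}"
    by (simp add: p_def poly_monom frob_funpow N_def)
  also have "\<dots> = set xs"
    by (simp add: xs poly_poly_of_roots_eq_0_iff)
  also have "card \<dots> = N"
    using \<open>distinct xs\<close> deg by (simp add: xs distinct_card)
  finally show ?thesis by (simp add: N_def)
qed

lemma sum_powers_less:
  assumes "(q :: nat) \<ge> 2"
  shows   "(\<Sum>d\<in>{1..<n}. q ^ d) < q ^ n"
proof (induction n)
  case (Suc n)
  show ?case
  proof (cases "n = 0")
    case False
    hence "(\<Sum>d\<in>{1..<Suc n}. q ^ d) = (\<Sum>d\<in>{1..<n}. q ^ d) + q ^ n"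
      by simp
    also have "\<dots> < q ^ n + q ^ n"
      using Suc by simp
    also have "\<dots> \<le> q ^ Suc n"
      using assms by (simp flip: mult_2)
    finally show ?thesis .
  qed (use assms in auto)
qed auto

text \<open>By \<open>sum_powers_less\<close>, fewer than \<open>q ^ n\<close> elements have a
  positive period below \<open>n\<close>, so some \<open>x\<close> has least period exactly
  \<open>n\<close>, and its orbit polynomial is irreducible.\<close>

lemma ex_irreducible_of_degree:
  assumes "n > 0"
  shows   "\<exists>f :: 'a :: {finite, field} poly. lead_coeff f = 1 \<and> degree f = n \<and> irreducible f"
proof -
  define q where "q = card (UNIV :: 'a set)"
  have q: "q \<ge> 2"
    using card_UNIV_field_gt_1[where ?'a = 'a] by (simp add: q_def)
  define S where "S d = {x :: 'a alg_closure. (frob ^^ d) x = x}" for d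
  have card_S: "card (S d) = q ^ d" if "d > 0" for d
    using card_frob_funpow_fixed[OF that, where ?'a = 'a] by (simp add: S_def q_def)
  have "card (\<Union>d\<in>{1..<n}. S d) \<le> (\<Sum>d\<in>{1..<n}. card (S d))"
    by (rule card_UN_le) auto
  also have "\<dots> = (\<Sum>d\<in>{1..<n}. q ^ d)"
    by (intro sum.cong) (auto simp: card_S)
  also have "\<dots> < card (S n)"
    using sum_powers_less[OF q] assms by (simp add: card_S)
  finally have less: "card (\<Union>d\<in>{1..<n}. S d) < card (S n)" .
  have "finite (S d)" if "d > 0" for d
    using card_S[OF that] q by (intro card_ge_0_finite) simp
  hence "finite (\<Union>d\<in>{1..<n}. S d)" by auto
  hence "\<not>S n \<subseteq> (\<Union>d\<in>{1..<n}. S d)"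
    using card_mono[of "\<Union>d\<in>{1..<n}. S d" "S n"] less by linarith
  then obtain x where x: "x \<in> S n" "x \<notin> (\<Union>d\<in>{1..<n}. S d)"
    by blast
  have per: "(frob ^^ n) x = x" using x(1) by (simp add: S_def)
  have dist: "distinct (frob_orbit n x)"
    using x(2) by (intro distinct_frob_orbit) (auto simp: S_def)
  obtain f where f: "ac_poly f = poly_of_roots (frob_orbit n x)"
    using poly_of_roots_descends mset_map_frob_orbit[OF assms per] by blast
  show ?thesis
    using frob_orbit_irreducible[OF assms dist f] monic_of_ac_poly[OF f] by auto
qed

section \<open>Discriminants\<close>

text \<open>For the roots of a monic polynomial this is a square root of the discriminant; its sign
  depends on the order of the list.\<close>

fun vandermonde :: "'a :: comm_ring_1 list \<Rightarrow> 'a" where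
  "vandermonde [] = 1"
| "vandermonde (x # xs) = (\<Prod>y\<leftarrow>xs. x - y) * vandermonde xs"

text \<open>The last factor is the resultant of the monic polynomials with root lists
  \<open>xs\<close> and \<open>ys\<close>.\<close>

lemma vandermonde_append:
  "vandermonde (xs @ ys) = vandermonde xs * vandermonde ys * (\<Prod>x\<leftarrow>xs. \<Prod>y\<leftarrow>ys. x - y)"
  by (induction xs) (simp_all add: mult_ac)

lemma prod_list_map_minus: "(\<Prod>y\<leftarrow>xs. y - x) = (-1) ^ length xs * (\<Prod>y\<leftarrow>xs. x - y)"
  for x :: "'a :: comm_ring_1"
proof (induction xs)
  case (Cons y xs)
  have "(y - x) * ((-1) ^ n * P) = (-1) ^ Suc n * ((x - y) * P)" for n and P :: 'a
    by (simp add: algebra_simps)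
  thus ?case by (simp only: list.map prod_list.Cons Cons length_Cons)
qed auto

text \<open>Each difference involving \<open>x\<close> is reversed once; the factor is the sign of a
  cycle of length \<open>length xs + 1\<close>.\<close>

lemma vandermonde_rotate: "vandermonde (xs @ [x]) = (-1) ^ length xs * vandermonde (x # xs)"
  by (simp add: vandermonde_append prod_list_map_minus)

lemma prod_list_map_mset_cong:
  assumes "mset xs = mset ys"
  shows   "(\<Prod>x\<leftarrow>xs. f x) = (\<Prod>x\<leftarrow>ys. f x :: 'b :: comm_monoid_mult)"
  using assms by (metis mset_map prod_mset_prod_list)

lemma vandermonde_move: "vandermonde (xs @ x # ys) ^ 2 = vandermonde (x # xs @ ys) ^ 2"
proof (induction xs)
  case (Cons z xs)
  have "(z - x) ^ 2 = (x - z) ^ 2" by (rule power2_commute)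
  thus ?case using Cons by (simp add: power_mult_distrib mult_ac)
qed auto

text \<open>Reordering only changes signs, so the square is independent of the root list chosen by
  \<open>SOME\<close> in \<open>poly_roots_list\<close>.\<close>

lemma vandermonde_square_cong:
  assumes "mset xs = mset ys"
  shows   "vandermonde xs ^ 2 = vandermonde ys ^ 2"
  using assms
proof (induction xs arbitrary: ys)
  case (Cons x xs)
  have "x \<in> set ys" using Cons.prems by (metis list.set_intros(1) mset_eq_setD)
  then obtain us vs where ys: "ys = us @ x # vs" by (meson split_list)
  have "mset xs = mset (us @ vs)" using Cons.prems by (simp add: ys)
  thus ?case
    using Cons.IH[of "us @ vs"] prod_list_map_mset_cong[of xs "us @ vs" "\<lambda>y. x - y"]
    by (simp add: ys vandermonde_move power_mult_distrib)
qed auto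

lemma vandermonde_eq_0_iff: "vandermonde xs = 0 \<longleftrightarrow> \<not>distinct xs"
  for xs :: "'a :: idom list"
  by (induction xs) (auto simp: prod_list_zero_iff)

text \<open>For a list of length \<open>n\<close>, each of the \<open>n * (n - 1) div 2\<close>
  differences gains a factor \<open>c\<close>, and squaring doubles the exponent.\<close>

lemma vandermonde_map_mult:
  "vandermonde (map ((*) c) xs) ^ 2 = c ^ (length xs * (length xs - 1)) * vandermonde xs ^ 2"
proof (induction xs)
  case (Cons x xs)
  have "(\<Prod>y\<leftarrow>map ((*) c) xs. c * x - y) = c ^ length xs * (\<Prod>y\<leftarrow>xs. x - y)"
    by (induction xs) (simp_all add: algebra_simps)
  hence "vandermonde (map ((*) c) (x # xs)) ^ 2 =
           c ^ (2 * length xs) * (\<Prod>y\<leftarrow>xs. x - y) ^ 2 * vandermonde (map ((*) c) xs) ^ 2"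
    by (simp only: list.map vandermonde.simps power_mult_distrib mult.commute[of 2] power_mult)
  also have "\<dots> = c ^ (2 * length xs + length xs * (length xs - 1)) * vandermonde (x # xs) ^ 2"
    unfolding Cons by (simp only: vandermonde.simps power_mult_distrib power_add mult_ac)
  also have "2 * length xs + length xs * (length xs - 1) = length (x # xs) * (length (x # xs) - 1)"
    by (cases "length xs") auto
  finally show ?case .
qed auto

lemma frob_vandermonde: "frob (vandermonde xs) = vandermonde (map frob xs)"
  by (induction xs) (simp_all add: frob_mult frob_prod_list frob_diff o_def)

lemma vandermonde_square_nth:
  "(\<Prod>i<length xs. \<Prod>j\<in>{i<..<length xs}. (xs ! i - xs ! j) ^ 2) = vandermonde xs ^ 2"
proof (induction xs)
  case (Cons x xs)
  let ?n = "length xs"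
  have *: "{Suc i<..<Suc ?n} = Suc ` {i<..<?n}" "{0<..<Suc ?n} = Suc ` {..<?n}" for i
    by (auto simp: image_iff gr0_conv_Suc Suc_less_eq2)
  have "(\<Prod>j<?n. (x - xs ! j) ^ 2) = (\<Prod>y\<leftarrow>xs. x - y) ^ 2"
    by (simp add: prod.list_conv_set_nth atLeast0LessThan prod_power_distrib)
  thus ?case using Cons
    by (simp add: prod.lessThan_Suc_shift * prod.reindex power_mult_distrib
             del: prod.lessThan_Suc)
qed auto

text \<open>The map \<open>frob\<close> permutes the roots and so fixes the square, which therefore
  lies in the base field and is recovered by \<open>of_ac\<close>. In degree at most 1 the empty
  product matches the convention \<open>disc f = 1\<close>.\<close>

lemma to_ac_disc:
  fixes f :: "'a :: {finite, field} poly"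
  assumes "ac_poly f = poly_of_roots xs"
  shows   "to_ac (disc f) = vandermonde xs ^ 2"
proof -
  note f = monic_of_ac_poly[OF assms]
  have "frob (vandermonde xs ^ 2) = vandermonde xs ^ 2"
    using vandermonde_square_cong[OF mset_map_frob_roots[OF assms]]
    by (simp add: frob_power frob_vandermonde)
  hence range: "vandermonde xs ^ 2 \<in> range (to_ac :: 'a \<Rightarrow> _)"
    by (simp only: frob_fixed_iff)
  show ?thesis
  proof (cases "degree f \<le> 1")
    case True
    hence "vandermonde xs = 1"
      using f(2) by (cases xs) auto
    thus ?thesis using True by (simp add: disc_def)
  next
    case False
    define ys where "ys = poly_roots_list f"
    have "\<exists>xs. mset xs = proots (ac_poly f)" by (rule ex_mset)
    hence "mset ys = proots (ac_poly f)"
      unfolding ys_def poly_roots_list_def by (rule someI_ex)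
    hence ys: "mset ys = mset xs" by (simp add: assms)
    hence "length ys = degree f" by (metis f(2) size_mset)
    hence "(\<Prod>i<degree f. \<Prod>j\<in>{i<..<degree f}. (ys ! i - ys ! j) ^ 2) = vandermonde xs ^ 2"
      using vandermonde_square_nth[of ys] vandermonde_square_cong[OF ys] by simp
    hence "disc f = of_ac (vandermonde xs ^ 2)"
      using False f(1) by (simp add: disc_def Let_def ys_def)
    thus ?thesis using range by (simp add: to_ac_of_ac)
  qed
qed

section \<open>The quadratic character of a discriminant\<close>

definition quad_char :: "'a :: field \<Rightarrow> int" where
  "quad_char d = (if d = 0 then 0 else if \<exists>y. y ^ 2 = d then 1 else -1)"

lemma quad_char_eq_0_iff [simp]: "quad_char d = 0 \<longleftrightarrow> d = 0"
  by (simp add: quad_char_def)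

lemma quad_char_0 [simp]: "quad_char 0 = 0"
  by simp

lemma quad_char_1 [simp]: "quad_char 1 = 1"
  by (auto simp: quad_char_def intro: exI[of _ 1])

text \<open>Squaring shows that \<open>frob x\<close> is \<open>x\<close> or \<open>-x\<close>; it
  is \<open>x\<close> exactly when \<open>x\<close> lies in the base field, that is, when
  \<open>d\<close> is a square there.\<close>

lemma frob_sqrt:
  fixes d :: "'a :: {finite, field}"
  assumes "to_ac d = x ^ 2"
  shows   "frob x = of_int (quad_char d) * x"
proof -
  have "frob x ^ 2 = x ^ 2"
    by (simp flip: assms frob_power)
  hence pm: "frob x = x \<or> frob x = -x"
    by (simp add: power2_eq_iff)
  consider "d = 0" | y where "y ^ 2 = d" "d \<noteq> 0" | "\<nexists>y. y ^ 2 = d" "d \<noteq> 0"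
    by blast
  thus ?thesis
  proof cases
    case 1
    thus ?thesis using assms by simp
  next
    case 2
    hence "x ^ 2 = to_ac y ^ 2" using assms by auto
    hence "x = to_ac y \<or> x = -to_ac y" by (simp add: power2_eq_iff)
    hence "frob x = x" by (auto simp: frob_minus)
    thus ?thesis using 2 by (auto simp: quad_char_def)
  next
    case 3
    have "x \<notin> range to_ac"
      using 3 assms by (auto simp flip: to_ac_power)
    hence "frob x \<noteq> x" by (simp add: frob_fixed_iff)
    thus ?thesis using 3 pm by (simp add: quad_char_def)
  qed
qed

lemma two_neq_0_ac:
  assumes "odd (card (UNIV :: 'a :: {finite, field} set))"
  shows   "(2 :: 'a alg_closure) \<noteq> 0"
proof
  assume 2: "(2 :: 'a alg_closure) = 0"
  obtain k where k: "card (UNIV :: 'a set) = 2 * k + 1"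
    using assms by (auto elim: oddE)
  have "(0 :: 'a alg_closure) = of_nat (2 * k + 1)"
    using of_nat_card_UNIV_ac[where ?'a = 'a] by (simp add: k)
  thus False using 2 by simp
qed

text \<open>Converse of \<open>frob_sqrt\<close>: the sign with which \<open>frob\<close> acts on a
  nonzero square root determines the character, because 1 and -1 differ when \<open>q\<close> is
  odd.\<close>

lemma quad_char_unique:
  fixes d :: "'a :: {finite, field}"
  assumes "odd (card (UNIV :: 'a set))"
  assumes "to_ac d = x ^ 2" "x \<noteq> 0" "frob x = of_int s * x" "s = 1 \<or> s = -1"
  shows   "quad_char d = s"
proof -
  have "of_int (quad_char d) = (of_int s :: 'a alg_closure)"
    using frob_sqrt[OF assms(2)] assms(3,4) by simp
  moreover have "d \<noteq> 0" using assms(2,3) by auto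
  hence "quad_char d = 1 \<or> quad_char d = -1" by (simp add: quad_char_def)
  moreover have "(1 :: 'a alg_closure) \<noteq> -1"
    using two_neq_0_ac[OF assms(1)] by (simp add: eq_neg_iff_add_eq_0)
  ultimately show ?thesis
    using assms(5) by fastforce
qed

text \<open>The Frobenius permutes the roots cyclically, and a cycle of length \<open>n\<close> has sign
  \<open>(-1) ^ (n - 1)\<close>.\<close>
lemma frob_vandermonde_orbit:
  assumes "n > 0" "(frob ^^ n) x = x"
  shows   "frob (vandermonde (frob_orbit n x)) = (-1) ^ (n - 1) * vandermonde (frob_orbit n x)"
proof -
  have "frob_orbit n x \<noteq> []" using assms by (simp add: frob_orbit_def)
  then obtain y ys where ys: "frob_orbit n x = y # ys" by (cases "frob_orbit n x") auto
  have "length ys = n - 1" using arg_cong[OF ys, of length] by simp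
  have "frob (vandermonde (frob_orbit n x)) = vandermonde (ys @ [y])"
    by (simp add: frob_vandermonde map_frob_orbit[OF assms]) (simp add: ys)
  also have "\<dots> = (-1) ^ (n - 1) * vandermonde (frob_orbit n x)"
    by (simp only: vandermonde_rotate ys \<open>length ys = n - 1\<close>)
  finally show ?thesis .
qed

text \<open>The roots form one Frobenius cycle, and its sign is the factor by which
  \<open>frob\<close> acts on the square root of the discriminant.\<close>

lemma quad_char_disc_irreducible:
  fixes f :: "'a :: {finite, field} poly"
  assumes "odd (card (UNIV :: 'a set))" "irreducible f" "lead_coeff f = 1"
  shows   "quad_char (disc f) = (-1) ^ (degree f - 1)"
proof -
  obtain x where x: "degree f > 0" "(frob ^^ degree f) x = x" "distinct (frob_orbit (degree f) x)"
    "ac_poly f = poly_of_roots (frob_orbit (degree f) x)"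
    using irreducible_roots[OF assms(2,3)] by blast
  show ?thesis
  proof (rule quad_char_unique[OF assms(1) to_ac_disc[OF x(4)]])
    show "frob (vandermonde (frob_orbit (degree f) x)) =
            of_int ((-1) ^ (degree f - 1)) * vandermonde (frob_orbit (degree f) x)"
      using frob_vandermonde_orbit[OF x(1,2)] by simp
  qed (use x(3) in \<open>auto simp: vandermonde_eq_0_iff minus_one_power_iff\<close>)
qed

text \<open>A monic irreducible \<open>p\<close> is the minimal polynomial of each of its
  roots.\<close>

lemma irreducible_dvd_of_common_root:
  fixes p f :: "'a :: {finite, field} poly"
  assumes "irreducible p" "lead_coeff p = 1" "poly (ac_poly p) x = 0" "poly (ac_poly f) x = 0"
  shows   "p dvd f"
proof -
  obtain n p' where p': "ac_poly p' = poly_of_roots (frob_orbit n x)" "irreducible p'"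
      "\<And>f. poly (ac_poly f) x = 0 \<Longrightarrow> p' dvd f"
    using frob_orbit_poly[of x] by metis
  have "p' = p"
    using assms p' monic_of_ac_poly[OF p'(1)]
    by (intro monic_dvd_irreducible_eq) (auto simp: irreducible_def)
  thus ?thesis using p'(3) assms by blast
qed

text \<open>By Stickelberger's theorem this is the usual Moebius function of a monic polynomial.\<close>
definition moebius :: "'a :: field poly \<Rightarrow> int" where
  "moebius f = (-1) ^ degree f * quad_char (disc f)"

text \<open>Appending the roots of \<open>p\<close> contributes the sign
  \<open>(-1) ^ (degree p - 1)\<close> of their cycle and the resultant, which is nonzero and fixed
  by \<open>frob\<close>. The degree sign in \<open>moebius\<close> then leaves a single factor
  -1.\<close>

lemma moebius_mult_irreducible:
  fixes d p :: "'a :: {finite, field} poly"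
  assumes odd: "odd (card (UNIV :: 'a set))"
  assumes d: "lead_coeff d = 1" and p: "irreducible p" "lead_coeff p = 1" and ndvd: "\<not>p dvd d"
  shows   "moebius (d * p) = -moebius d"
proof -
  obtain xs where xs: "ac_poly d = poly_of_roots xs" by (rule ac_poly_splits[OF d])
  define n where "n = degree p"
  obtain x where x: "n > 0" "(frob ^^ n) x = x" "distinct (frob_orbit n x)"
    "ac_poly p = poly_of_roots (frob_orbit n x)"
    using irreducible_roots[OF p] unfolding n_def by blast
  define ys where "ys = frob_orbit n x"
  have dp: "ac_poly (d * p) = poly_of_roots (xs @ ys)"
    by (simp add: ac_poly_mult xs x ys_def)
  define R where "R = (\<Prod>x\<leftarrow>xs. \<Prod>y\<leftarrow>ys. x - y)"
  have R0: "R \<noteq> 0"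
  proof
    assume "R = 0"
    then obtain y where "y \<in> set xs" "y \<in> set ys"
      by (auto simp: R_def prod_list_zero_iff)
    hence "p dvd d"
      using irreducible_dvd_of_common_root[OF p, of y d]
      by (simp add: xs x poly_poly_of_roots_eq_0_iff ys_def)
    with ndvd show False ..
  qed
  \<comment> \<open>The map \<open>frob\<close> permutes each of the two root lists, so it fixes the
    resultant.\<close>
  have "frob R = (\<Prod>x\<leftarrow>map frob xs. \<Prod>y\<leftarrow>map frob ys. x - y)"
    by (simp add: R_def frob_prod_list frob_diff o_def)
  also have "\<dots> = (\<Prod>x\<leftarrow>xs. \<Prod>y\<leftarrow>map frob ys. x - y)"
    by (rule prod_list_map_mset_cong) (rule mset_map_frob_roots[OF xs])
  also have "\<dots> = R" unfolding R_def ys_def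
    using prod_list_map_mset_cong[OF mset_map_frob_roots[OF x(4)]] by metis
  finally have R: "frob R = R" .
  have deg: "degree (d * p) = degree d + n"
    using d p by (subst degree_mult_eq) (auto simp: n_def)
  note vdm = vandermonde_append[of xs ys, folded R_def]
  have "quad_char (disc (d * p)) = (-1) ^ (n - 1) * quad_char (disc d)"
  proof (cases "disc d = 0")
    case True
    hence "vandermonde xs = 0" using to_ac_disc[OF xs] by simp
    hence "disc (d * p) = 0" using to_ac_disc[OF dp] vdm by simp
    with True show ?thesis by simp
  next
    case False
    hence "vandermonde xs \<noteq> 0" using to_ac_disc[OF xs] by auto
    show ?thesis
    proof (rule quad_char_unique[OF odd to_ac_disc[OF dp]])
      show "vandermonde (xs @ ys) \<noteq> 0"
        using R0 \<open>vandermonde xs \<noteq> 0\<close> x(3) by (simp add: vdm vandermonde_eq_0_iff flip: ys_def)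
      show "frob (vandermonde (xs @ ys)) =
              of_int ((-1) ^ (n - 1) * quad_char (disc d)) * vandermonde (xs @ ys)"
        using frob_vandermonde_orbit[OF x(1,2)] frob_sqrt[OF to_ac_disc[OF xs]]
        by (simp add: vdm frob_mult R flip: ys_def)
      show "(-1) ^ (n - 1) * quad_char (disc d) = 1 \<or> (-1) ^ (n - 1) * quad_char (disc d) = -1"
        using False by (simp add: quad_char_def minus_one_power_iff)
    qed
  qed
  thus ?thesis using x(1) by (cases n) (simp_all add: moebius_def deg power_add)
qed

text \<open>A repeated root of \<open>f\<close> makes its minimal polynomial divide \<open>f\<close>
  twice; conversely, the roots of \<open>p\<close> occur at least twice in a multiple of
  \<open>p ^ 2\<close>.\<close>

lemma disc_eq_0_iff:
  fixes f :: "'a :: {finite, field} poly"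
  assumes f: "lead_coeff f = 1"
  shows   "disc f = 0 \<longleftrightarrow> (\<exists>p. irreducible p \<and> lead_coeff p = 1 \<and> p ^ 2 dvd f)"
proof -
  obtain xs where xs: "ac_poly f = poly_of_roots xs" by (rule ac_poly_splits[OF f])
  have disc: "disc f = 0 \<longleftrightarrow> \<not>distinct xs"
    using to_ac_disc[OF xs] vandermonde_eq_0_iff[of xs] by (metis power_eq_0_iff pos2 to_ac_eq_0_iff)
  show ?thesis
  proof
    assume "disc f = 0"
    hence "\<not>distinct xs" using disc by simp
    then obtain x us vs ws where "xs = us @ [x] @ vs @ [x] @ ws"
      using not_distinct_decomp by blast
    hence "poly_of_roots xs = poly_of_roots (x # x # us @ vs @ ws)"
      by (intro poly_of_roots_cong) simp
    hence f2: "ac_poly f = [:-x, 1:] * ([:-x, 1:] * poly_of_roots (us @ vs @ ws))"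
      by (simp only: xs poly_of_roots_simps)
    obtain n p where p: "n > 0" "distinct (frob_orbit n x)"
        "ac_poly p = poly_of_roots (frob_orbit n x)" "irreducible p"
        "\<And>f. poly (ac_poly f) x = 0 \<Longrightarrow> p dvd f"
      using frob_orbit_poly[of x] by metis
    obtain ys where ys: "frob_orbit n x = x # ys"
      using p(1) by (cases n) (auto simp: frob_orbit_def map_upt_Suc simp del: upt_Suc)
    have "poly (ac_poly f) x = 0" by (simp add: f2 del: mult_pCons_left)
    then obtain g where g: "f = p * g" using p(5) by (auto elim: dvdE)
    have "[:-x, 1:] * (poly_of_roots ys * ac_poly g) =
          [:-x, 1:] * ([:-x, 1:] * poly_of_roots (us @ vs @ ws))"
      unfolding f2[symmetric] g ac_poly_mult p(3) ys by (simp only: poly_of_roots_simps mult_ac)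
    \<comment> \<open>One factor is cancelled; the second must come from \<open>g\<close>, since
      \<open>x\<close> occurs only once in its orbit.\<close>
    hence "poly_of_roots ys * ac_poly g = [:-x, 1:] * poly_of_roots (us @ vs @ ws)"
      by (subst (asm) mult_cancel_left) simp
    hence "poly (poly_of_roots ys * ac_poly g) x = 0"
      by (simp del: mult_pCons_left)
    moreover have "x \<notin> set ys" using p(2) ys by simp
    ultimately have "poly (ac_poly g) x = 0"
      by (simp add: poly_poly_of_roots_eq_0_iff)
    hence "p dvd g" by (rule p(5))
    hence "p ^ 2 dvd f" by (simp add: g power2_eq_square)
    thus "\<exists>p. irreducible p \<and> lead_coeff p = 1 \<and> p ^ 2 dvd f"
      using p(4) monic_of_ac_poly[OF p(3)] by blast
  next
    assume "\<exists>p. irreducible p \<and> lead_coeff p = 1 \<and> p ^ 2 dvd f"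
    then obtain p g where p: "irreducible p" "lead_coeff p = 1" "f = p ^ 2 * g"
      unfolding dvd_def by blast
    have "g \<noteq> 0" using p f by auto
    obtain ys where ys: "degree p > 0" "ac_poly p = poly_of_roots ys"
      using irreducible_roots[OF p(1,2)] by metis
    then obtain y where y: "y \<in> set ys"
      using monic_of_ac_poly(2)[OF ys(2)] by (cases ys) auto
    have "mset xs = proots (ac_poly f)" by (simp add: xs)
    also have "\<dots> = mset ys + mset ys + proots (ac_poly g)"
      using \<open>g \<noteq> 0\<close> by (simp add: p(3) power2_eq_square ac_poly_mult ys proots_mult)
    finally have "count (mset xs) y = 2 * count (mset ys) y + count (proots (ac_poly g)) y"
      by simp
    moreover have "count (mset ys) y > 0"
      using y by simp
    ultimately have "count (mset xs) y \<ge> 2"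
      by linarith
    moreover from this have "y \<in> set xs"
      by (metis count_mset_0_iff not_numeral_le_zero)
    ultimately have "count (mset xs) y \<noteq> (if y \<in> set xs then 1 else 0)"
      by simp
    hence "\<not>distinct xs"
      unfolding distinct_count_atmost_1 by blast
    thus "disc f = 0"
      using disc by simp
  qed
qed

section \<open>Counting by the Moebius function\<close>

definition monics :: "nat \<Rightarrow> 'a :: field poly set" where
  "monics n = {f. lead_coeff f = 1 \<and> degree f = n}"

lemma monics_0: "monics 0 = {1}"
  by (auto simp: monics_def elim!: degree_eq_zeroE)

lemma monics_Suc: "monics (Suc n) = (\<lambda>(a, g). pCons a g) ` (UNIV \<times> monics n)"
proof (intro equalityI subsetI)
  fix f :: "'a poly" assume f: "f \<in> monics (Suc n)"
  obtain a g where ag: "f = pCons a g" by (cases f)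
  with f have "g \<in> monics n" by (auto simp: monics_def split: if_splits)
  thus "f \<in> (\<lambda>(a, g). pCons a g) ` (UNIV \<times> monics n)" using ag by auto
next
  fix f :: "'a poly" assume "f \<in> (\<lambda>(a, g). pCons a g) ` (UNIV \<times> monics n)"
  thus "f \<in> monics (Suc n)" by (auto simp: monics_def)
qed

lemma finite_monics [simp, intro]: "finite (monics n :: 'a :: {finite, field} poly set)"
  by (induction n) (simp_all add: monics_0 monics_Suc)

lemma card_monics: "card (monics n :: 'a :: {finite, field} poly set) = card (UNIV :: 'a set) ^ n"
proof (induction n)
  case (Suc n)
  have "inj_on (\<lambda>(a, g). pCons a g) (UNIV \<times> monics n :: ('a \<times> 'a poly) set)"
    by (auto simp: inj_on_def)
  thus ?case using Suc by (simp add: monics_Suc card_image card_cartesian_product)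
qed (simp_all add: monics_0)

lemma card_monics_dvd:
  fixes g :: "'a :: {finite, field} poly"
  assumes "lead_coeff g = 1" "degree g \<le> n"
  shows   "card {f \<in> monics n. g dvd f} = card (UNIV :: 'a set) ^ (n - degree g)"
proof -
  have "g \<noteq> 0" using assms by auto
  have "{f \<in> monics n. g dvd f} = (*) g ` monics (n - degree g)"
  proof (intro equalityI subsetI)
    fix f assume "f \<in> {f \<in> monics n. g dvd f}"
    then obtain h where h: "f = g * h" "lead_coeff f = 1" "degree f = n"
      by (auto simp: monics_def elim: dvdE)
    hence "h \<noteq> 0" by auto
    moreover have "lead_coeff h = 1"
      using h(2) assms(1) by (simp only: h(1) lead_coeff_mult mult_1)
    ultimately have "h \<in> monics (n - degree g)"
      using h(1,3) \<open>g \<noteq> 0\<close> by (auto simp: monics_def degree_mult_eq)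
    thus "f \<in> (*) g ` monics (n - degree g)" using h by auto
  next
    fix f assume "f \<in> (*) g ` monics (n - degree g)"
    then obtain h where h: "f = g * h" "lead_coeff h = 1" "degree h = n - degree g"
      unfolding monics_def by blast
    hence "h \<noteq> 0" by auto
    hence "degree f = n" using h assms \<open>g \<noteq> 0\<close> by (simp add: degree_mult_eq)
    moreover have "lead_coeff f = 1" using h(1,2) assms(1) by (simp add: lead_coeff_mult)
    ultimately show "f \<in> {f \<in> monics n. g dvd f}" by (simp add: monics_def h(1))
  qed
  moreover have "inj_on ((*) g) (monics (n - degree g))"
    using \<open>g \<noteq> 0\<close> by (auto simp: inj_on_def)
  ultimately show ?thesis by (simp add: card_image card_monics)
qed

section \<open>Divisor sums of the Moebius function\<close>

lemma moebius_eq_0_iff: "moebius f = 0 \<longleftrightarrow> disc f = 0"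
  by (simp add: moebius_def)

lemma moebius_1 [simp]: "moebius 1 = 1"
  by (simp add: moebius_def disc_def)

text \<open>The terms \<open>d\<close> and \<open>d * p\<close> with \<open>d\<close> not divisible by \<open>p\<close> cancel, and
  those divisible by \<open>p\<^sup>2\<close> vanish.\<close>
lemma sum_moebius_eq_0:
  fixes p :: "'a :: {finite, field} poly"
  assumes odd: "odd (card (UNIV :: 'a set))"
  assumes p: "irreducible p" "lead_coeff p = 1"
  assumes fin: "finite S" and monic: "\<And>d. d \<in> S \<Longrightarrow> lead_coeff d = 1"
    and mult: "\<And>d. d \<in> S \<Longrightarrow> \<not>p dvd d \<Longrightarrow> d * p \<in> S"
    and divide: "\<And>d. d * p \<in> S \<Longrightarrow> d \<in> S"
  shows "(\<Sum>d\<in>S. moebius d) = 0"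
proof -
  define S0 where "S0 = {d \<in> S. \<not>p dvd d}"
  have "p \<noteq> 0" using p by auto
  have sub: "(\<lambda>d. d * p) ` S0 \<subseteq> S - S0"
    using mult by (auto simp: S0_def)
  have "moebius d = 0" if d: "d \<in> (S - S0) - (\<lambda>d. d * p) ` S0" for d
  proof -
    from d have "p dvd d" by (auto simp: S0_def)
    then obtain e where e: "d = e * p" by (metis dvdE mult.commute)
    with d have "e \<in> S" using divide by auto
    with d e have "p dvd e" by (auto simp: S0_def)
    hence "p ^ 2 dvd d" by (auto simp: e power2_eq_square)
    thus ?thesis using disc_eq_0_iff[of d] monic[of d] d p by (auto simp: moebius_eq_0_iff)
  qed
  hence "(\<Sum>d\<in>S - S0. moebius d) = (\<Sum>d\<in>(\<lambda>d. d * p) ` S0. moebius d)"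
    using fin sub by (intro sum.mono_neutral_right) auto
  also have "\<dots> = (\<Sum>d\<in>S0. moebius (d * p))"
    using \<open>p \<noteq> 0\<close> by (subst sum.reindex) (auto simp: inj_on_def)
  also have "\<dots> = (\<Sum>d\<in>S0. -moebius d)"
    by (intro sum.cong) (auto simp: S0_def moebius_mult_irreducible[OF odd monic p])
  finally have "(\<Sum>d\<in>S - S0. moebius d) = -(\<Sum>d\<in>S0. moebius d)"
    by (simp add: sum_negf)
  moreover have "(\<Sum>d\<in>S. moebius d) = (\<Sum>d\<in>S - S0. moebius d) + (\<Sum>d\<in>S0. moebius d)"
    using fin by (intro sum.subset_diff) (auto simp: S0_def)
  ultimately show ?thesis by simp
qed

lemma finite_monic_power_dvd:
  fixes f :: "'a :: {finite, field} poly"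
  assumes "f \<noteq> 0" "r > 0"
  shows   "finite {d. lead_coeff d = 1 \<and> d ^ r dvd f}"
proof (rule finite_subset)
  show "{d. lead_coeff d = 1 \<and> d ^ r dvd f} \<subseteq> (\<Union>n\<le>degree f. monics n)"
  proof clarify
    fix d :: "'a poly" assume d: "lead_coeff d = 1" "d ^ r dvd f"
    hence "d dvd f" using assms(2) by (meson dvd_power dvd_trans)
    thus "d \<in> (\<Union>n\<le>degree f. monics n)"
      using d assms by (auto simp: monics_def dvd_imp_degree_le)
  qed
qed auto

text \<open>Any monic irreducible divisor \<open>p\<close> of \<open>f\<close> allows the
  cancellation of \<open>sum_moebius_eq_0\<close>: if \<open>p\<close> does not divide
  \<open>d\<close>, primality puts it into the cofactor of \<open>d\<close>.\<close>

lemma sum_moebius_dvd: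
  fixes f :: "'a :: {finite, field} poly"
  assumes "odd (card (UNIV :: 'a set))" "degree f > 0"
  shows   "(\<Sum>d | lead_coeff d = 1 \<and> d dvd f. moebius d) = 0"
proof -
  have "f \<noteq> 0" using assms by auto
  obtain p where p: "irreducible p" "lead_coeff p = 1" "p dvd f"
    using ex_irreducible_dvd[OF assms(2)] by blast
  show ?thesis
  proof (rule sum_moebius_eq_0[OF assms(1) p(1,2)])
    show "finite {d. lead_coeff d = 1 \<and> d dvd f}"
      using finite_monic_power_dvd[OF \<open>f \<noteq> 0\<close>, of 1] by simp
    show "d * p \<in> {d. lead_coeff d = 1 \<and> d dvd f}"
      if d: "d \<in> {d. lead_coeff d = 1 \<and> d dvd f}" "\<not>p dvd d" for d
    proof -
      obtain e where e: "f = d * e" using d(1) unfolding dvd_def by blast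
      hence "p dvd e"
        using p d field_poly_irreducible_imp_prime[OF p(1)] by (auto dest: prime_elem_dvd_multD)
      thus ?thesis using d p(2) by (auto simp: e lead_coeff_mult mult_dvd_mono)
    qed
    show "d \<in> {d. lead_coeff d = 1 \<and> d dvd f}"
      if "d * p \<in> {d. lead_coeff d = 1 \<and> d dvd f}" for d
      using that p(2) by (auto simp: lead_coeff_mult intro: dvd_mult_left)
  qed auto
qed

text \<open>If the discriminant is nonzero, \<open>f\<close> is squarefree and only
  \<open>d = 1\<close> contributes; otherwise some \<open>p ^ 2\<close> divides \<open>f\<close> and
  \<open>sum_moebius_eq_0\<close> applies.\<close>

lemma sum_moebius_square_dvd:
  fixes f :: "'a :: {finite, field} poly"
  assumes "odd (card (UNIV :: 'a set))" "lead_coeff f = 1"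
  shows   "(\<Sum>d | lead_coeff d = 1 \<and> d ^ 2 dvd f. moebius d) = (if disc f = 0 then 0 else 1)"
proof (cases "disc f = 0")
  case True
  have "f \<noteq> 0" using assms by auto
  obtain p where p: "irreducible p" "lead_coeff p = 1" "p ^ 2 dvd f"
    using True disc_eq_0_iff[OF assms(2)] by blast
  note prime = field_poly_irreducible_imp_prime[OF p(1)]
  have "(\<Sum>d | lead_coeff d = 1 \<and> d ^ 2 dvd f. moebius d) = 0"
  proof (rule sum_moebius_eq_0[OF assms(1) p(1,2)])
    show "finite {d. lead_coeff d = 1 \<and> d ^ 2 dvd f}"
      using finite_monic_power_dvd[OF \<open>f \<noteq> 0\<close>] by simp
    show "d * p \<in> {d. lead_coeff d = 1 \<and> d ^ 2 dvd f}"
      if d: "d \<in> {d. lead_coeff d = 1 \<and> d ^ 2 dvd f}" "\<not>p dvd d" for d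
    proof -
      obtain e where e: "f = d ^ 2 * e" using d(1) unfolding dvd_def by blast
      \<comment> \<open>Both copies of \<open>p\<close> must divide the cofactor \<open>e\<close>,
        so \<open>(d * p) ^ 2\<close> still divides \<open>f\<close>.\<close>
      have nd: "\<not>p dvd d ^ 2" using prime d(2) by (auto dest: prime_elem_dvd_power)
      have "p dvd d ^ 2 * e" using p(3) unfolding e by (metis dvd_power dvd_trans pos2)
      then obtain e' where e': "e = p * e'"
        using nd prime by (auto dest: prime_elem_dvd_multD elim: dvdE)
      have "p * p dvd p * (d ^ 2 * e')"
        using p(3) by (simp add: e e' power2_eq_square mult_ac)
      hence "p dvd d ^ 2 * e'"
        using prime by (subst (asm) dvd_mult_cancel_left) (auto simp: prime_elem_def)
      hence "p dvd e'"
        using nd prime by (auto dest: prime_elem_dvd_multD)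
      hence "(d * p) ^ 2 dvd f"
        by (auto simp: e e' power2_eq_square mult_ac intro!: mult_dvd_mono)
      thus ?thesis using d p(2) by (auto simp: lead_coeff_mult)
    qed
    show "d \<in> {d. lead_coeff d = 1 \<and> d ^ 2 dvd f}"
      if "d * p \<in> {d. lead_coeff d = 1 \<and> d ^ 2 dvd f}" for d
      using that p(2) by (auto simp: lead_coeff_mult power_mult_distrib intro: dvd_mult_left)
  qed auto
  thus ?thesis using True by simp
next
  case False
  have "d = 1" if d: "lead_coeff d = 1" "d ^ 2 dvd f" for d
  proof (rule ccontr)
    assume "d \<noteq> 1"
    hence "degree d > 0" using d(1) by (auto elim!: degree_eq_zeroE intro!: Nat.gr0I)
    then obtain p where p: "irreducible p" "lead_coeff p = 1" "p dvd d"
      using ex_irreducible_dvd by blast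
    hence "p ^ 2 dvd f" using d(2) by (meson dvd_power_same dvd_trans)
    with p False show False using disc_eq_0_iff[OF assms(2)] by blast
  qed
  hence "{d. lead_coeff d = 1 \<and> d ^ 2 dvd f} = {1}" by auto
  thus ?thesis using False by simp
qed

text \<open>The \<open>itself\<close> argument carries the field, which the types of
  \<open>n\<close> and of the result do not mention.\<close>

definition sum_moebius :: "'a :: {finite, field} itself \<Rightarrow> nat \<Rightarrow> int" where
  "sum_moebius _ n = (\<Sum>f\<in>(monics n :: 'a poly set). moebius f)"

text \<open>Double counting: for each monic \<open>d\<close> of degree \<open>k\<close>, exactly
  \<open>q ^ (n - r * k)\<close> elements of \<open>monics n\<close> are multiples of
  \<open>d ^ r\<close>. The case \<open>r = 1\<close> gives a recurrence, \<open>r = 2\<close> the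
  squarefree count.\<close>

lemma sum_sum_moebius_power_dvd:
  fixes n r :: nat
  assumes "r > 0"
  shows "(\<Sum>f\<in>(monics n :: 'a :: {finite, field} poly set).
            \<Sum>d | lead_coeff d = 1 \<and> d ^ r dvd f. moebius d) =
         (\<Sum>k | r * k \<le> n. sum_moebius TYPE('a) k * int (card (UNIV :: 'a set)) ^ (n - r * k))"
    (is "?lhs = ?rhs")
proof -
  define K where "K = {k. r * k \<le> n}"
  have "K \<subseteq> {..n}" using assms by (auto simp: K_def intro: order.trans[rotated])
  hence "finite K" by (rule finite_subset) auto
  \<comment> \<open>A finite range for \<open>d\<close> that does not depend on \<open>f\<close>, so
    that the two sums can be swapped.\<close>
  define D :: "'a poly set" where "D = (\<Union>k\<in>K. monics k)"
  have "finite D" using \<open>finite K\<close> by (auto simp: D_def)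
  have deg: "degree (d ^ r) = r * k" "lead_coeff (d ^ r) = 1" if "d \<in> monics k" for d :: "'a poly" and k
    using that by (auto simp: monics_def lead_coeff_power intro!: degree_power_eq)
  have D: "{d. lead_coeff d = 1 \<and> d ^ r dvd f} = {d \<in> D. d ^ r dvd f}" if "f \<in> monics n" for f
  proof -
    have "d \<in> D" if d: "lead_coeff d = 1" "d ^ r dvd f" for d
    proof -
      have "degree (d ^ r) \<le> degree f"
        using d \<open>f \<in> monics n\<close> by (intro dvd_imp_degree_le) (auto simp: monics_def)
      hence "degree d \<in> K"
        using d(1) \<open>f \<in> monics n\<close> deg(1)[of d "degree d"] by (auto simp: K_def monics_def)
      thus ?thesis using d(1) by (auto simp: D_def monics_def)
    qed
    thus ?thesis by (auto simp: D_def monics_def)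
  qed
  have "?lhs = (\<Sum>f\<in>monics n. \<Sum>d\<in>D. if d ^ r dvd f then moebius d else 0)"
    using \<open>finite D\<close> by (intro sum.cong[OF refl]) (simp only: D sum.inter_filter)
  also have "\<dots> = (\<Sum>d\<in>D. \<Sum>f\<in>monics n. if d ^ r dvd f then moebius d else 0)"
    by (rule sum.swap)
  also have "\<dots> = (\<Sum>d\<in>D. moebius d * int (card {f \<in> monics n. d ^ r dvd f}))"
    by (intro sum.cong) (simp_all add: mult.commute flip: sum.inter_filter)
  also have "\<dots> = (\<Sum>k\<in>K. \<Sum>d\<in>monics k. moebius (d :: 'a poly) * int (card {f \<in> monics n. d ^ r dvd f}))"
    unfolding D_def using \<open>finite K\<close> by (intro sum.UNION_disjoint) (simp_all, auto simp: monics_def)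
  also have "\<dots> = (\<Sum>k\<in>K. \<Sum>d\<in>monics k. moebius (d :: 'a poly) * int (card (UNIV :: 'a set)) ^ (n - r * k))"
  proof (intro sum.cong refl)
    fix k and d :: "'a poly" assume "k \<in> K" "d \<in> monics k"
    thus "moebius d * int (card {f \<in> monics n. d ^ r dvd f}) =
            moebius d * int (card (UNIV :: 'a set)) ^ (n - r * k)"
      using card_monics_dvd[of "d ^ r" n] deg[of d k] by (simp add: K_def)
  qed
  also have "\<dots> = ?rhs"
    by (simp add: K_def sum_moebius_def sum_distrib_right)
  finally show ?thesis .
qed

lemma sum_moebius_recurrence:
  assumes "odd (card (UNIV :: 'a :: {finite, field} set))" "n > 0"
  shows   "(\<Sum>k\<le>n. sum_moebius TYPE('a) k * int (card (UNIV :: 'a set)) ^ (n - k)) = 0"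
proof -
  have "(\<Sum>k\<le>n. sum_moebius TYPE('a) k * int (card (UNIV :: 'a set)) ^ (n - k)) =
        (\<Sum>f\<in>(monics n :: 'a poly set). \<Sum>d | lead_coeff d = 1 \<and> d dvd f. moebius d)"
    using sum_sum_moebius_power_dvd[of 1 n, where ?'a = 'a] by (simp add: atMost_def)
  also have "\<dots> = 0"
    using assms by (intro sum.neutral) (auto simp: monics_def sum_moebius_dvd)
  finally show ?thesis .
qed

lemma sum_moebius_0: "sum_moebius TYPE('a :: {finite, field}) 0 = 1"
  by (simp add: sum_moebius_def monics_0)

lemma sum_moebius_1:
  assumes "odd (card (UNIV :: 'a :: {finite, field} set))"
  shows   "sum_moebius TYPE('a) 1 = -int (card (UNIV :: 'a set))"
  using sum_moebius_recurrence[OF assms, of 1] sum_moebius_0[where ?'a = 'a] by simp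

text \<open>In the recurrence for \<open>n\<close>, the terms with index below \<open>n\<close> add
  up to \<open>q\<close> times the recurrence for \<open>n - 1\<close>, which vanishes because
  \<open>n - 1 > 0\<close>.\<close>

lemma sum_moebius_ge_2:
  assumes "odd (card (UNIV :: 'a :: {finite, field} set))" "n \<ge> 2"
  shows   "sum_moebius TYPE('a) n = 0"
proof -
  define q where "q = int (card (UNIV :: 'a set))"
  define M where "M = sum_moebius TYPE('a)"
  obtain l where l: "n = Suc l" "l > 0" using assms(2) by (cases n) auto
  have "(\<Sum>k\<le>l. M k * q ^ (Suc l - k)) = q * (\<Sum>k\<le>l. M k * q ^ (l - k))"
    by (simp add: sum_distrib_left Suc_diff_le mult_ac)
  thus ?thesis
    using sum_moebius_recurrence[OF assms(1), of l] sum_moebius_recurrence[OF assms(1), of n] l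
    by (simp add: M_def q_def)
qed

text \<open>In the sum for \<open>r = 2\<close> only \<open>k = 0\<close> and \<open>k = 1\<close>
  survive, giving \<open>q ^ n - q ^ (n - 1)\<close> squarefree polynomials; the rest have
  discriminant zero.\<close>

lemma card_monics_disc_0:
  assumes odd: "odd (card (UNIV :: 'a :: {finite, field} set))" and n: "n \<ge> 2"
  shows   "card {f \<in> (monics n :: 'a poly set). disc f = 0} = card (UNIV :: 'a set) ^ (n - 1)"
proof -
  define q where "q = card (UNIV :: 'a set)"
  let ?S = "monics n :: 'a poly set"
  have "(\<Sum>f\<in>?S. if disc f = 0 then 0 else 1 :: int) =
        (\<Sum>f\<in>?S. \<Sum>d | lead_coeff d = 1 \<and> d ^ 2 dvd f. moebius d)"
    by (intro sum.cong) (auto simp: monics_def sum_moebius_square_dvd[OF odd])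
  also have "\<dots> = (\<Sum>k | 2 * k \<le> n. sum_moebius TYPE('a) k * int q ^ (n - 2 * k))"
    unfolding q_def by (rule sum_sum_moebius_power_dvd) auto
  also have "\<dots> = (\<Sum>k\<in>{0, 1}. sum_moebius TYPE('a) k * int q ^ (n - 2 * k))"
  proof (rule sum.mono_neutral_right)
    have "{k. 2 * k \<le> n} \<subseteq> {..n}" by auto
    thus "finite {k. 2 * k \<le> n}" by (rule finite_subset) auto
  qed (use n in \<open>auto simp: sum_moebius_ge_2[OF odd]\<close>)
  also have "\<dots> = int q ^ n - int q * int q ^ (n - 2)"
    by (simp add: sum_moebius_0 sum_moebius_1[OF odd, unfolded One_nat_def] q_def)
  also have "int q * int q ^ (n - 2) = int q ^ (n - 1)"
    using n by (simp add: Suc_diff_Suc numeral_2_eq_2 flip: power_Suc)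
  finally have "(\<Sum>f\<in>?S. if disc f = 0 then 0 else 1 :: int) = int q ^ n - int q ^ (n - 1)" .
  moreover have "(\<Sum>f\<in>?S. if disc f = 0 then 0 else 1 :: int) + (\<Sum>f\<in>?S. if disc f = 0 then 1 else 0)
                   = (\<Sum>f\<in>?S. 1)"
    unfolding sum.distrib[symmetric] by (intro sum.cong) auto
  moreover have "(\<Sum>f\<in>?S. if disc f = 0 then 1 else 0) = int (card {f \<in> ?S. disc f = 0})"
    by (simp flip: sum.inter_filter)
  ultimately have "int (card {f \<in> ?S. disc f = 0}) = int (q ^ (n - 1))"
    by (simp add: card_monics q_def)
  thus ?thesis unfolding q_def by (simp only: of_nat_eq_iff)
qed

lemma sum_quad_char_disc:
  assumes odd: "odd (card (UNIV :: 'a :: {finite, field} set))" and n: "n \<ge> 2"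
  shows   "(\<Sum>f\<in>(monics n :: 'a poly set). quad_char (disc f)) = 0"
proof -
  have "0 = sum_moebius TYPE('a) n" using sum_moebius_ge_2[OF assms] by simp
  also have "\<dots> = (\<Sum>f\<in>(monics n :: 'a poly set). (-1) ^ n * quad_char (disc f))"
    unfolding sum_moebius_def by (intro sum.cong) (auto simp: monics_def moebius_def)
  finally show ?thesis by (simp flip: sum_distrib_left)
qed

section \<open>Scaling the roots\<close>

lemma two_neq_0_field:
  assumes "odd (card (UNIV :: 'a :: {finite, field} set))"
  shows   "(2 :: 'a) \<noteq> 0"
  using two_neq_0_ac[OF assms] by (metis to_ac_0 to_ac_numeral)

text \<open>Squaring on the nonzero elements has fibres \<open>{z, -z}\<close> of size two.\<close>

lemma card_squares:
  assumes odd: "odd (card (UNIV :: 'a :: {finite, field} set))"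
  shows "2 * card {d :: 'a. quad_char d = 1} = card (UNIV :: 'a set) - 1"
proof -
  have *: "quad_char d = 1 \<longleftrightarrow> d \<noteq> 0 \<and> (\<exists>y. y ^ 2 = d)" for d :: 'a
    by (auto simp: quad_char_def)
  have fibre: "card {y \<in> UNIV - {0}. y ^ 2 = d} = 2" if d: "quad_char d = 1" for d :: 'a
  proof -
    obtain z where z: "z ^ 2 = d" "d \<noteq> 0" using d * by blast
    hence "{y \<in> UNIV - {0}. y ^ 2 = d} = {z, -z}" by (auto simp: power2_eq_iff)
    moreover have "z \<noteq> -z"
    proof
      assume "z = -z"
      hence "2 * z = 0" by (metis add.right_inverse mult_2)
      thus False using z two_neq_0_field[OF odd] by auto
    qed
    ultimately show ?thesis by simp
  qed
  have "card (UNIV - {0} :: 'a set) = (\<Sum>y\<in>(UNIV - {0} :: 'a set). 1)" by simp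
  also have "\<dots> = (\<Sum>d\<in>{d :: 'a. quad_char d = 1}. \<Sum>y\<in>{y \<in> UNIV - {0}. y ^ 2 = d}. 1)"
    by (rule sum.group[symmetric]) (auto simp: *)
  also have "\<dots> = (\<Sum>d\<in>{d :: 'a. quad_char d = 1}. 2)"
    by (intro sum.cong refl) (simp only: fibre mem_Collect_eq flip: card_eq_sum)
  finally show ?thesis by (simp add: mult.commute)
qed

lemma card_nonsquares:
  assumes odd: "odd (card (UNIV :: 'a :: {finite, field} set))"
  shows "2 * card {d :: 'a. quad_char d = -1} = card (UNIV :: 'a set) - 1"
proof -
  have "{d :: 'a. quad_char d = 1} \<union> {d. quad_char d = -1} = UNIV - {0}"
    by (auto simp: quad_char_def)
  moreover have "card ({d :: 'a. quad_char d = 1} \<union> {d. quad_char d = -1}) =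
        card {d :: 'a. quad_char d = 1} + card {d :: 'a. quad_char d = -1}"
    by (intro card_Un_disjoint) auto
  ultimately have "card {d :: 'a. quad_char d = 1} + card {d :: 'a. quad_char d = -1} =
                   card (UNIV :: 'a set) - 1"
    by simp
  thus ?thesis using card_squares[OF odd] by simp
qed

lemma quad_char_mult_square:
  fixes a t :: "'a :: field"
  assumes "t \<noteq> 0"
  shows   "quad_char (t ^ 2 * a) = quad_char a"
proof -
  have "(\<exists>y. y ^ 2 = t ^ 2 * a) \<longleftrightarrow> (\<exists>y. y ^ 2 = a)"
  proof
    assume "\<exists>y. y ^ 2 = t ^ 2 * a"
    then obtain y where "y ^ 2 = t ^ 2 * a" by blast
    hence "(y / t) ^ 2 = a" using assms by (simp add: power_divide)
    thus "\<exists>y. y ^ 2 = a" by blast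
  qed (metis power_mult_distrib)
  thus ?thesis using assms by (simp add: quad_char_def)
qed

text \<open>Multiplication by \<open>a\<close> maps the nonzero squares injectively into the class
  of \<open>a\<close>; both sets have the same size, so \<open>b\<close> is reached.\<close>

lemma quad_char_eqD:
  fixes a b :: "'a :: {finite, field}"
  assumes odd: "odd (card (UNIV :: 'a set))"
  assumes "a \<noteq> 0" "quad_char a = quad_char b"
  obtains t where "t \<noteq> 0" "b = t ^ 2 * a"
proof -
  let ?S = "{d :: 'a. quad_char d = 1}" and ?T = "{d :: 'a. quad_char d = quad_char a}"
  have "quad_char a = 1 \<or> quad_char a = -1"
    using assms(2) by (auto simp: quad_char_def)
  hence "card ?T = card ?S"
    using card_squares[OF odd] card_nonsquares[OF odd] by auto
  moreover have "card ((\<lambda>d. d * a) ` ?S) = card ?S"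
    using assms(2) by (intro card_image) (auto simp: inj_on_def)
  moreover have "(\<lambda>d. d * a) ` ?S \<subseteq> ?T"
  proof clarify
    fix d :: 'a assume "quad_char d = 1"
    then obtain t where "t ^ 2 = d" "d \<noteq> 0" by (auto simp: quad_char_def split: if_splits)
    thus "quad_char (d * a) = quad_char a" using quad_char_mult_square[of t a] by auto
  qed
  ultimately have "(\<lambda>d. d * a) ` ?S = ?T" by (intro card_subset_eq) auto
  hence "b \<in> (\<lambda>d. d * a) ` ?S" using assms(3) by simp
  then obtain d where d: "quad_char d = 1" "b = d * a" by auto
  then obtain t where "t ^ 2 = d" "d \<noteq> 0" by (auto simp: quad_char_def split: if_splits)
  thus ?thesis using that[of t] d(2) by auto
qed

text \<open>Bezout gives \<open>k * x = (q - 1) * y + 2\<close>; as \<open>t ^ (q - 1) = 1\<close>,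
  the element \<open>t ^ x\<close> is a \<open>k\<close>-th root of \<open>t ^ 2\<close>.\<close>

lemma square_eq_power:
  fixes t :: "'a :: {finite, field}"
  assumes "gcd (card (UNIV :: 'a set) - 1) k = 2" "k > 0" "t \<noteq> 0"
  obtains c where "c \<noteq> 0" "c ^ k = t ^ 2"
proof -
  obtain x y where xy: "k * x = (card (UNIV :: 'a set) - 1) * y + gcd k (card (UNIV :: 'a set) - 1)"
    using bezout_nat[of k] assms(2) by (metis not_gr0)
  have "t * t ^ (card (UNIV :: 'a set) - 1) = t"
    using power_card_UNIV_eq_same[of t] card_UNIV_field_gt_1[where ?'a = 'a]
    by (simp flip: power_Suc)
  hence "t ^ (card (UNIV :: 'a set) - 1) = 1" using assms(3) by simp
  hence "t ^ (k * x) = t ^ 2"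
    using assms(1) by (simp add: xy power_add power_mult gcd.commute power2_eq_square)
  hence "(t ^ x) ^ k = t ^ 2" by (simp add: mult.commute flip: power_mult)
  thus ?thesis using that[of "t ^ x"] assms(3) by simp
qed

section \<open>The scaling map and its effect on discriminant counts\<close>

lemma frob_orbit_mult:
  "frob_orbit n (to_ac c * x) = map ((*) (to_ac c)) (frob_orbit n x)"
proof -
  have "(frob ^^ i) (to_ac c * x) = to_ac c * (frob ^^ i) x" for i
    by (induction i) (simp_all add: frob_mult)
  thus ?thesis by (simp add: frob_orbit_def)
qed

text \<open>On monic \<open>f\<close> of degree \<open>m\<close>, the map \<open>h\<close> sends
  \<open>f(X)\<close> to \<open>c ^ m * f(X / c)\<close>. It is obtained by descent: the scaled root
  list is stable under \<open>frob\<close> because \<open>frob\<close> fixes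
  \<open>c\<close>.\<close>

lemma scale_roots:
  fixes c :: "'a :: {finite, field}"
  assumes "c \<noteq> 0"
  obtains h where "inj_on h {f. lead_coeff f = 1}"
    "\<And>f xs. ac_poly f = poly_of_roots xs \<Longrightarrow> ac_poly (h f) = poly_of_roots (map ((*) (to_ac c)) xs)"
proof -
  let ?c = "(*) (to_ac c)"
  have "\<exists>g. \<forall>xs. ac_poly f = poly_of_roots xs \<longrightarrow> ac_poly g = poly_of_roots (map ?c xs)"
    for f :: "'a poly"
  proof (cases "\<exists>xs. ac_poly f = poly_of_roots xs")
    case True
    then obtain xs where xs: "ac_poly f = poly_of_roots xs" by blast
    have "map frob (map ?c xs) = map ?c (map frob xs)" by (simp add: frob_mult)
    hence "mset (map frob (map ?c xs)) = image_mset ?c (mset (map frob xs))"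
      by (metis mset_map)
    also have "\<dots> = mset (map ?c xs)"
      unfolding mset_map_frob_roots[OF xs] by simp
    finally obtain g where g: "ac_poly g = poly_of_roots (map ?c xs)"
      by (rule poly_of_roots_descends)
    have "poly_of_roots (map ?c ys) = poly_of_roots (map ?c xs)" if "ac_poly f = poly_of_roots ys" for ys
    proof (rule poly_of_roots_cong)
      have "mset ys = mset xs" using that xs by (metis proots_poly_of_roots)
      thus "mset (map ?c ys) = mset (map ?c xs)" by simp
    qed
    thus ?thesis using g by auto
  qed auto
  then obtain h where h: "\<And>f xs. ac_poly f = poly_of_roots xs \<Longrightarrow> ac_poly (h f) = poly_of_roots (map ?c xs)"
    by metis
  have "inj_on h {f. lead_coeff f = 1}"
  proof (rule inj_onI)
    fix f g :: "'a poly"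
    assume fg: "f \<in> {f. lead_coeff f = 1}" "g \<in> {f. lead_coeff f = 1}" and eq: "h f = h g"
    obtain xs where xs: "ac_poly f = poly_of_roots xs"
      using ac_poly_splits[of f] fg by blast
    obtain ys where ys: "ac_poly g = poly_of_roots ys"
      using ac_poly_splits[of g] fg by blast
    have "mset (map ?c xs) = mset (map ?c ys)"
      using h[OF xs] h[OF ys] eq by (metis proots_poly_of_roots)
    moreover have "inj ?c" using assms by (auto simp: inj_def)
    ultimately have "mset xs = mset ys"
      using multiset.inj_map by (metis injD mset_map)
    thus "f = g" using xs ys poly_of_roots_cong by (metis ac_poly_eq_iff)
  qed
  thus ?thesis using that h by blast
qed

text \<open>The flag \<open>irr\<close> lets one scaling argument serve both (i) and (ii).\<close>

definition count_disc :: "bool \<Rightarrow> nat \<Rightarrow> 'a :: field \<Rightarrow> nat" where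
  "count_disc irr m d = card {f \<in> monics m. (irr \<longrightarrow> irreducible f) \<and> disc f = d}"

text \<open>The scaling map is injective and turns Frobenius orbits into Frobenius orbits, so it
  preserves irreducibility. An inequality suffices, since \<open>count_disc_cong\<close> uses it in
  both directions.\<close>

lemma count_disc_scale:
  fixes c d :: "'a :: {finite, field}"
  assumes "c \<noteq> 0"
  shows   "count_disc irr m d \<le> count_disc irr m (c ^ (m * (m - 1)) * d)"
proof -
  obtain h :: "'a poly \<Rightarrow> 'a poly" where inj: "inj_on h {f. lead_coeff f = 1}"
    and h: "\<And>f xs. ac_poly f = poly_of_roots xs \<Longrightarrow> ac_poly (h f) = poly_of_roots (map ((*) (to_ac c)) xs)"
    using scale_roots[OF assms] by blast
  show ?thesis unfolding count_disc_def
  proof (rule card_inj_on_le)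
    show "inj_on h {f \<in> monics m. (irr \<longrightarrow> irreducible f) \<and> disc f = d}"
      using inj by (rule inj_on_subset) (auto simp: monics_def)
    show "h ` {f \<in> monics m. (irr \<longrightarrow> irreducible f) \<and> disc f = d} \<subseteq>
            {f \<in> monics m. (irr \<longrightarrow> irreducible f) \<and> disc f = c ^ (m * (m - 1)) * d}"
    proof clarify
      fix f :: "'a poly"
      assume f: "f \<in> monics m" "irr \<longrightarrow> irreducible f"
      then obtain xs where xs: "ac_poly f = poly_of_roots xs"
        by (metis (mono_tags, lifting) ac_poly_splits mem_Collect_eq monics_def)
      have m: "length xs = m" using monic_of_ac_poly(2)[OF xs] f by (simp add: monics_def)
      have "to_ac (disc (h f)) = to_ac (c ^ (m * (m - 1)) * disc f)"
        by (simp add: to_ac_disc[OF h[OF xs]] to_ac_disc[OF xs] vandermonde_map_mult m)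
      hence "disc (h f) = c ^ (m * (m - 1)) * disc f"
        by (simp only: to_ac_eq_iff)
      moreover have "h f \<in> monics m"
        using monic_of_ac_poly[OF h[OF xs]] m by (simp add: monics_def)
      moreover have "irreducible (h f)" if irr: irr
      proof -
        obtain x where x: "m > 0" "distinct (frob_orbit m x)"
          "ac_poly f = poly_of_roots (frob_orbit m x)"
          using irreducible_roots[of f] f irr unfolding monics_def by blast
        show ?thesis
        proof (rule frob_orbit_irreducible[OF x(1)])
          show "distinct (frob_orbit m (to_ac c * x))"
            using x(2) assms by (simp add: frob_orbit_mult distinct_map inj_on_def)
          show "ac_poly (h f) = poly_of_roots (frob_orbit m (to_ac c * x))"
            using h[OF x(3)] by (simp add: frob_orbit_mult)
        qed
      qed
      ultimately show "h f \<in> monics m \<and> (irr \<longrightarrow> irreducible (h f)) \<and>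
                         disc (h f) = c ^ (m * (m - 1)) * disc f" by simp
    qed
  qed (auto intro: finite_subset[OF _ finite_monics])
qed

text \<open>Nonzero elements of equal character differ by a factor \<open>t ^ 2\<close>, which the
  gcd condition makes an \<open>m * (m - 1)\<close>-th power of some nonzero
  \<open>c\<close>.\<close>

lemma count_disc_cong:
  fixes a b :: "'a :: {finite, field}"
  assumes odd: "odd (card (UNIV :: 'a set))"
    and m: "m \<ge> 2" "gcd (card (UNIV :: 'a set) - 1) (m * (m - 1)) = 2"
    and ab: "quad_char a = quad_char b"
  shows   "count_disc irr m a = count_disc irr m b"
proof (cases "a = 0")
  case True
  thus ?thesis using ab by (metis quad_char_eq_0_iff)
next
  case a: False
  have le: "count_disc irr m a \<le> count_disc irr m b"
    if ab: "a \<noteq> 0" "quad_char a = quad_char b" for a b :: 'a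
  proof -
    obtain t where t: "t \<noteq> 0" "b = t ^ 2 * a" using quad_char_eqD[OF odd ab] by blast
    obtain c where "c \<noteq> 0" "c ^ (m * (m - 1)) = t ^ 2"
      using square_eq_power[OF m(2) _ t(1)] m(1) by auto
    thus ?thesis using count_disc_scale[of c irr m a] t(2) by simp
  qed
  moreover have "b \<noteq> 0" using a ab by (metis quad_char_eq_0_iff)
  ultimately show ?thesis using a ab by (intro antisym) auto
qed

text \<open>Taking for \<open>g\<close> the constant 1 and then \<open>quad_char\<close> yields two
  linear equations for the counts.\<close>

lemma sum_over_disc:
  fixes g :: "'a :: {finite, field} \<Rightarrow> int"
  shows "(\<Sum>f\<in>monics m. g (disc f)) = (\<Sum>d\<in>UNIV. int (count_disc False m d) * g d)"
proof -
  have "(\<Sum>f\<in>monics m. g (disc f)) = (\<Sum>d\<in>UNIV. \<Sum>f\<in>{f \<in> monics m. disc f = d}. g (disc f))"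
    by (rule sum.group[symmetric]) auto
  also have "\<dots> = (\<Sum>d\<in>UNIV. int (count_disc False m d) * g d)"
    by (intro sum.cong) (auto simp: count_disc_def)
  finally show ?thesis .
qed

text \<open>The count is constant on nonzero squares and on nonsquares. The vanishing character sum
  makes both values equal; the total \<open>q ^ m\<close> and the known count at 0 then determine
  them.\<close>

lemma count_disc_all:
  fixes d :: "'a :: {finite, field}"
  assumes odd: "odd (card (UNIV :: 'a set))"
    and m: "m \<ge> 2" "gcd (card (UNIV :: 'a set) - 1) (m * (m - 1)) = 2"
  shows   "count_disc False m d = card (UNIV :: 'a set) ^ (m - 1)"
proof -
  define q where "q = card (UNIV :: 'a set)"
  define N where "N d = int (count_disc False m d)" for d :: 'a
  let ?S = "{d :: 'a. quad_char d = 1}" and ?T = "{d :: 'a. quad_char d = -1}"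
  have q: "q > 1" using card_UNIV_field_gt_1[where ?'a = 'a] by (simp add: q_def)
  have UNIV_eq: "(UNIV :: 'a set) = insert 0 (?S \<union> ?T)"
    by (auto simp: quad_char_def)
  have split: "(\<Sum>d\<in>UNIV. g d) = g 0 + (\<Sum>d\<in>?S. g d) + (\<Sum>d\<in>?T. g d)" for g :: "'a \<Rightarrow> int"
    by (subst UNIV_eq, subst sum.insert, simp, simp, subst sum.union_disjoint) auto
  define h where "h = card ?S"
  have h: "card ?S = h" "card ?T = h" "2 * h = q - 1"
    using card_squares[OF odd] card_nonsquares[OF odd] by (simp_all add: q_def h_def)
  hence "h > 0" using q by linarith
  hence "card ?S > 0" "card ?T > 0" by (simp_all add: h)
  \<comment> \<open>Representatives of the two classes, which are nonempty because each has
    \<open>(q - 1) div 2 > 0\<close> elements.\<close>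
  then obtain s t where "s \<in> ?S" "t \<in> ?T"
    by (metis card_gt_0_iff ex_in_conv)
  hence st: "quad_char s = 1" "quad_char t = -1" by auto
  have N_cong: "N a = N b" if "quad_char a = quad_char b" for a b
    using count_disc_cong[OF odd m that] by (simp add: N_def)
  have "(\<Sum>d\<in>?S. N d) = (\<Sum>d\<in>?S. N s)"
    by (intro sum.cong refl N_cong) (simp add: st)
  hence S: "(\<Sum>d\<in>?S. N d) = int h * N s" by (simp add: h)
  have "(\<Sum>d\<in>?T. N d) = (\<Sum>d\<in>?T. N t)"
    by (intro sum.cong refl N_cong) (simp add: st)
  hence T: "(\<Sum>d\<in>?T. N d) = int h * N t" by (simp add: h)
  have N0: "N 0 = int (q ^ (m - 1))"
    using card_monics_disc_0[OF odd m(1)] by (simp add: N_def count_disc_def q_def)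
  have "int q ^ m = N 0 + (\<Sum>d\<in>?S. N d) + (\<Sum>d\<in>?T. N d)"
    using sum_over_disc[of "\<lambda>_ :: 'a. 1" m] by (simp add: split N_def card_monics q_def)
  moreover have "0 = (\<Sum>d\<in>?S. N d) - (\<Sum>d\<in>?T. N d)"
    using sum_over_disc[of "quad_char :: 'a \<Rightarrow> int" m] sum_quad_char_disc[OF odd m(1)]
    by (simp add: split N_def sum_negf)
  ultimately have eqs: "int q ^ m = int q ^ (m - 1) + int h * N s + int h * N t"
      "int h * N s = int h * N t"
    by (simp_all add: S T N0)
  with \<open>h > 0\<close> have "N t = N s" by simp
  have "int q * int q ^ (m - 1) = int q ^ m"
    using m(1) by (simp flip: power_Suc)
  also have "\<dots> = int q ^ (m - 1) + (2 * int h) * N s"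
    using eqs(1) by (simp add: \<open>N t = N s\<close>)
  also have "2 * int h = int q - 1"
    using h(3) q by linarith
  finally have "(int q - 1) * (N s - int q ^ (m - 1)) = 0"
    by (simp add: algebra_simps)
  hence Ns: "N s = int q ^ (m - 1)"
    using q by simp
  have "N d = int q ^ (m - 1)"
  proof -
    consider "d = 0" | "quad_char d = quad_char s" | "quad_char d = quad_char t"
      using UNIV_eq st by auto
    thus ?thesis
      using N0 Ns \<open>N t = N s\<close> N_cong[of d s] N_cong[of d t] by cases auto
  qed
  hence "int (count_disc False m d) = int (q ^ (m - 1))" by (simp add: N_def)
  thus ?thesis unfolding q_def by (simp only: of_nat_eq_iff)
qed

theorem theorem1p1:
  fixes m :: nat
  assumes q_odd: "odd (card (UNIV :: 'a :: {finite, field} set))"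
    and m_ge: "m \<ge> 2"
    and gcd_cond: "gcd (card (UNIV :: 'a set) - 1) (m * (m - 1)) = 2"
  shows "(\<forall>d :: 'a. card {f :: 'a poly. lead_coeff f = 1 \<and> degree f = m \<and> disc f = d}
                    = card (UNIV :: 'a set) ^ (m - 1))
     \<and> (\<exists>A :: 'a set. A \<subseteq> UNIV - {0} \<and> card A = (card (UNIV :: 'a set) - 1) div 2
          \<and> (\<forall>f :: 'a poly. lead_coeff f = 1 \<and> degree f = m \<and> irreducible f \<longrightarrow> disc f \<in> A)
          \<and> (\<exists>c > 0. \<forall>a \<in> A. card {f :: 'a poly. lead_coeff f = 1 \<and> degree f = m
                                   \<and> irreducible f \<and> disc f = a} = c))"
proof (intro conjI allI)
  fix d :: 'a
  show "card {f :: 'a poly. lead_coeff f = 1 \<and> degree f = m \<and> disc f = d} =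
          card (UNIV :: 'a set) ^ (m - 1)"
    using count_disc_all[OF q_odd m_ge gcd_cond, of d]
    by (simp add: count_disc_def monics_def conj_assoc)
next
  \<comment> \<open>The class dictated by \<open>quad_char_disc_irreducible\<close>: nonzero squares
    for odd \<open>m\<close>, nonsquares for even \<open>m\<close>.\<close>
  define A where "A = {d :: 'a. quad_char d = (-1) ^ (m - 1)}"
  have disc_A: "disc f \<in> A" if "lead_coeff f = 1" "degree f = m" "irreducible f" for f :: "'a poly"
    using quad_char_disc_irreducible[OF q_odd that(3,1)] that(2) by (simp add: A_def)
  \<comment> \<open>This \<open>f\<close> makes the count at \<open>disc f\<close> positive, and
    \<open>count_disc_cong\<close> carries it to all of \<open>A\<close>.\<close>
  obtain f :: "'a poly" where f: "lead_coeff f = 1" "degree f = m" "irreducible f"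
    using ex_irreducible_of_degree[of m] m_ge by auto
  have "A \<subseteq> UNIV - {0}" by (auto simp: A_def)
  moreover have "card A = (card (UNIV :: 'a set) - 1) div 2"
    using card_squares[OF q_odd] card_nonsquares[OF q_odd]
    by (auto simp: A_def minus_one_power_iff)
  moreover have "count_disc True m (disc f) > 0"
    unfolding count_disc_def card_gt_0_iff
    using f by (auto simp: monics_def intro: finite_subset[OF _ finite_monics[of m]])
  moreover have "card {f :: 'a poly. lead_coeff f = 1 \<and> degree f = m \<and> irreducible f \<and> disc f = a} =
                   count_disc True m (disc f)" if "a \<in> A" for a
    using count_disc_cong[OF q_odd m_ge gcd_cond, of a "disc f" True] disc_A[OF f] that
    by (simp add: A_def count_disc_def monics_def conj_assoc)
  ultimately show "\<exists>A :: 'a set. A \<subseteq> UNIV - {0} \<and> card A = (card (UNIV :: 'a set) - 1) div 2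
          \<and> (\<forall>f :: 'a poly. lead_coeff f = 1 \<and> degree f = m \<and> irreducible f \<longrightarrow> disc f \<in> A)
          \<and> (\<exists>c > 0. \<forall>a \<in> A. card {f :: 'a poly. lead_coeff f = 1 \<and> degree f = m
                                   \<and> irreducible f \<and> disc f = a} = c)"
    using disc_A by blast
qed

end
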